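(* Let $(\Gamma,\alpha)$ be a $d$-valent, 3-independent, non-cyclic abstract one-skeleton, let $\xi\in\mathcal P$ be generic, let $\phi:V_\Gamma\to\mathbb R$ be an injective $\xi$-compatible function and $c$ a regular value of $\phi$. Then the Kirwan map $\mathcal K_c:H(\Gamma,\alpha)\to H(\Gamma_c,\alpha^c)$ is surjective.
   Context: $\mathfrak g$ is an $n$-dimensional real vector space, $\mathfrak g^*$ its dual, $\mathbb S(\cdot)=\bigoplus_k\mathbb S^k(\cdot)$ denotes the symmetric algebra. Abstract one-skeleton: a finite $d$-valent graph $\Gamma$ (multiple edges allowed) with vertex set $V_\Gamma$ and set $E_\Gamma$ of oriented edges (each edge occurs with both orientations; $i(e),t(e)$ are the initial and terminal vertices of $e$, $\bar e$ is $e$ reversed, $E_p=\{e: i(e)=p\}$ has $d$ elements), a connection $\theta$, i.e. bijections $\theta_e:E_{i(e)}\to E_{t(e)}$ with $\theta_{\bar e}=\theta_e^{-1}$, and an axial function $\alpha:E_\Gamma\to\mathfrak g^*$ such that: (A1) for every $p$ the vectors $\alpha_e$, $e\in E_p$, are pairwise linearly independent; (A2) for every $e$ there are positive numbers $m_e,m_{\bar e}$ with $m_{\bar e}\alpha_{\bar e}=-m_e\alpha_e$; (A3) for every $e$ and $e_i\in E_{i(e)}$, $\alpha_{\theta_e(e_i)}=\lambda_{i,e}\alpha_{e_i}+c_{i,e}\alpha_e$ with $\lambda_{i,e}>0$, $c_{i,e}\in\mathbb R$. 3-independent: for every $p$, any three distinct $e\in E_p$ have linearly independent $\alpha_e$.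 $\mathcal P=\{\xi\in\mathfrak g:\alpha_e(\xi)\ne0\ \forall e\}$. For $\xi\in\mathcal P$ the index of $p$ is the number of $e\in E_p$ with $\alpha_e(\xi)<0$, and $b_{2i}$ is the number of vertices of index $i$ (independent of $\xi$). $\phi:V_\Gamma\to\mathbb R$ is $\xi$-compatible if $\phi(t(e))>\phi(i(e))$ whenever $\alpha_e(\xi)>0$; $c$ is a regular value if $c\notin\phi(V_\Gamma)$. $\xi$ is generic if for every vertex $p$ and distinct $e_1,e_2,e_3,e_4\in E_p$ the vectors $\iota_\xi(\alpha_{e_1}\wedge\alpha_{e_2})$ and $\iota_\xi(\alpha_{e_3}\wedge\alpha_{e_4})$ are linearly independent, where $\iota_\xi(\beta\wedge\gamma)=\beta(\xi)\gamma-\gamma(\xi)\beta$. For a subspace $\mathfrak h\subset\mathfrak g$, $\Gamma_{\mathfrak h}$ is the subgraph whose edges are those $e$ with $\alpha_e\in\mathfrak h^\perp$. Non-cyclic: (NCA1) for some $\xi\in\mathcal P$ the graph with edges oriented so that $\alpha_e(\xi)>0$ has no oriented cycles; (NCA2) for every codimension 2 subspace $\mathfrak h$, every connected component of $\Gamma_{\mathfrak h}$ has $b_0=1$. Cohomology ring: $H(\Gamma,\alpha)$ is the ring of maps $f:V_\Gamma\to\mathbb S(\mathfrak g^* )$ with $f(i(e))-f(t(e))\in\alpha_e\mathbb S(\mathfrak g^* )$ for all $e\in E_\Gamma$. Reduction. Let $\mathfrak g_\xi^*=\{\eta\in\mathfrak g^*:\eta(\xi)=0\}$. The reduced one-skeleton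 $(\Gamma_c,\alpha^c)$: its vertices $v_e$ are the unoriented edges $e$ of $\Gamma$ crossing $c$, i.e. joining vertices $e_-,e_+$ with $\phi(e_-)<c<\phi(e_+)$. Let $\alpha_e^{\downarrow}$ be the value of $\alpha$ on $e$ oriented from $e_+$ to $e_-$. For each $a\in E_{e_+}$ different from $e$, let $\mathfrak h_a\subset\mathfrak g$ be the annihilator of $\mathrm{span}(\alpha_e^\downarrow,\alpha_a)$ and $C$ the connected component of $\Gamma_{\mathfrak h_a}$ containing $e_+$; $C$ is a cycle containing exactly one other edge $e_a$ crossing $c$. Each such $a$ gives an edge of $\Gamma_c$ joining $v_e$ to $v_{e_a}$, with $\alpha^c_{v_ev_{e_a}}=\alpha_a-\frac{\alpha_a(\xi)}{\alpha_e^\downarrow(\xi)}\alpha_e^\downarrow\in\mathfrak g_\xi^*$. $H(\Gamma_c,\alpha^c)$ is the ring of maps $g$ from the vertices of $\Gamma_c$ to $\mathbb S(\mathfrak g_\xi^* )$ such that for each edge of $\Gamma_c$ the difference of the values of $g$ at its endpoints is divisible in $\mathbb S(\mathfrak g_\xi^* )$ by the value of $\alpha^c$ on that edge. Kirwan map: for $f\in H(\Gamma,\alpha)$, $\mathcal K_c(f)(v_e)$ is the image of $f(e_+)$ (equivalently of $f(e_-)$) under $\mathbb S(\mathfrak g^* )\to\mathbb S(\mathfrak g^*/\mathbb R\alpha_e)\cong\mathbb S(\mathfrak g_\xi^* )$, where the isomorphism is induced by the bijective composition $\mathfrak g_\xi^*\hookrightarrow\mathfrak g^*\to\mathfrak g^*/\mathbb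 R\alpha_e$. It takes values in $H(\Gamma_c,\alpha^c)$. *)

theory Defs
  imports
    "HOL-Analysis.Analysis"
    "HOL-Library.Poly_Mapping"
    "Graph_Theory.Bidirected_Digraph"
    "Graph_Theory.Digraph_Component"
begin

section \<open>The symmetric algebra of a real vector space\<close>

text \<open>
  The type \<open>'v multiset \<Rightarrow>\<^sub>0 real\<close> with its convolution product is the free commutative real algebra
  on the set of all vectors of \<open>'v\<close>.  The symmetric algebra is its quotient by the ideal that
  makes the inclusion of the generators linear.
\<close>

definition free_gen :: "'v \<Rightarrow> 'v multiset \<Rightarrow>\<^sub>0 real" where
  "free_gen v = Poly_Mapping.single {#v#} 1"

definition free_const :: "real \<Rightarrow> 'v multiset \<Rightarrow>\<^sub>0 real" where
  "free_const r = Poly_Mapping.single {#} r"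

inductive_set sym_ideal :: "('v::real_vector multiset \<Rightarrow>\<^sub>0 real) set" where
  sym_ideal_add_rel: "free_gen (v + w) - free_gen v - free_gen w \<in> sym_ideal"
| sym_ideal_scale_rel: "free_gen (r *\<^sub>R v) - free_const r * free_gen v \<in> sym_ideal"
| sym_ideal_add: "p \<in> sym_ideal \<Longrightarrow> q \<in> sym_ideal \<Longrightarrow> p + q \<in> sym_ideal"
| sym_ideal_mult: "p \<in> sym_ideal \<Longrightarrow> s * p \<in> sym_ideal"

lemma sym_ideal_zero: "0 \<in> sym_ideal"
  using sym_ideal_mult[OF sym_ideal_add_rel, of 0] by simp

lemma sym_ideal_uminus: "p \<in> sym_ideal \<Longrightarrow> - p \<in> sym_ideal"
  using sym_ideal_mult[of p "- 1"] by simp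

lemma sym_ideal_diff: "p \<in> sym_ideal \<Longrightarrow> q \<in> sym_ideal \<Longrightarrow> p - q \<in> sym_ideal"
  using sym_ideal_add[of p "- q"] sym_ideal_uminus[of q] by simp

lemma lookup_times_empty:
  fixes p q :: "'v multiset \<Rightarrow>\<^sub>0 real"
  shows "Poly_Mapping.lookup (p * q) {#} = Poly_Mapping.lookup p {#} * Poly_Mapping.lookup q {#}"
proof -
  have "Poly_Mapping.lookup (p * q) {#} = (\<Sum>k. Poly_Mapping.lookup p k * (\<Sum>l. Poly_Mapping.lookup q l when {#} = k + l))"
    by (simp add: lookup_mult)
  also have "\<dots> = (\<Sum>k. Poly_Mapping.lookup p k * Poly_Mapping.lookup q {#} when k = {#})"
  proof (rule Sum_any.cong)
    fix k :: "'v multiset"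
    show "Poly_Mapping.lookup p k * (\<Sum>l. Poly_Mapping.lookup q l when {#} = k + l) = (Poly_Mapping.lookup p k * Poly_Mapping.lookup q {#} when k = {#})"
    proof (cases "k = {#}")
      case True
      then show ?thesis by simp
    next
      case False
      then have "\<And>l. (Poly_Mapping.lookup q l when {#} = k + l) = 0"
        by (simp add: when_def)
      then show ?thesis using False by simp
    qed
  qed
  also have "\<dots> = Poly_Mapping.lookup p {#} * Poly_Mapping.lookup q {#}"
    by (simp only: Sum_any_when_equal)
  finally show ?thesis .
qed

lemma sym_ideal_lookup_empty: "p \<in> sym_ideal \<Longrightarrow> Poly_Mapping.lookup p {#} = 0"
  by (induction rule: sym_ideal.induct)
    (simp_all add: free_gen_def lookup_minus lookup_add lookup_single lookup_times_empty)

lemma one_notin_sym_ideal: "1 \<notin> sym_ideal"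
  using sym_ideal_lookup_empty[of 1] by (auto simp: lookup_one)

lemma minus_one_notin_sym_ideal: "- 1 \<notin> sym_ideal"
  using one_notin_sym_ideal sym_ideal_uminus[of "- 1"] by auto

quotient_type (overloaded) 'v sym_alg = "'v::real_vector multiset \<Rightarrow>\<^sub>0 real" / "\<lambda>p q. p - q \<in> sym_ideal"
proof (rule equivpI)
  show "reflp (\<lambda>p q :: 'v multiset \<Rightarrow>\<^sub>0 real. p - q \<in> sym_ideal)"
    by (rule reflpI) (simp add: sym_ideal_zero)
  show "symp (\<lambda>p q :: 'v multiset \<Rightarrow>\<^sub>0 real. p - q \<in> sym_ideal)"
    by (rule sympI) (drule sym_ideal_uminus, simp)
  show "transp (\<lambda>p q :: 'v multiset \<Rightarrow>\<^sub>0 real. p - q \<in> sym_ideal)"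
    by (rule transpI) (drule (1) sym_ideal_add, simp)
qed

instantiation sym_alg :: (real_vector) comm_ring_1
begin

lift_definition zero_sym_alg :: "'a sym_alg" is 0 .

lift_definition one_sym_alg :: "'a sym_alg" is 1 .

lift_definition plus_sym_alg :: "'a sym_alg \<Rightarrow> 'a sym_alg \<Rightarrow> 'a sym_alg" is "(+)"
proof -
  fix p p' q q' :: "'a multiset \<Rightarrow>\<^sub>0 real"
  assume "p - p' \<in> sym_ideal" "q - q' \<in> sym_ideal"
  then have "(p - p') + (q - q') \<in> sym_ideal"
    by (rule sym_ideal_add)
  then show "(p + q) - (p' + q') \<in> sym_ideal"
    by (simp add: algebra_simps)
qed

lift_definition uminus_sym_alg :: "'a sym_alg \<Rightarrow> 'a sym_alg" is uminus
proof -
  fix p p' :: "'a multiset \<Rightarrow>\<^sub>0 real"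
  assume "p - p' \<in> sym_ideal"
  then have "- (p - p') \<in> sym_ideal"
    by (rule sym_ideal_uminus)
  then show "- p - - p' \<in> sym_ideal"
    by (simp add: algebra_simps)
qed

lift_definition minus_sym_alg :: "'a sym_alg \<Rightarrow> 'a sym_alg \<Rightarrow> 'a sym_alg" is "(-)"
proof -
  fix p p' q q' :: "'a multiset \<Rightarrow>\<^sub>0 real"
  assume "p - p' \<in> sym_ideal" "q - q' \<in> sym_ideal"
  then have "(p - p') - (q - q') \<in> sym_ideal"
    by (rule sym_ideal_diff)
  then show "(p - q) - (p' - q') \<in> sym_ideal"
    by (simp add: algebra_simps)
qed

lift_definition times_sym_alg :: "'a sym_alg \<Rightarrow> 'a sym_alg \<Rightarrow> 'a sym_alg" is "(*)"
proof -
  fix p p' q q' :: "'a multiset \<Rightarrow>\<^sub>0 real"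
  assume "p - p' \<in> sym_ideal" "q - q' \<in> sym_ideal"
  then have "q * (p - p') + p' * (q - q') \<in> sym_ideal"
    by (intro sym_ideal_add sym_ideal_mult)
  then show "p * q - p' * q' \<in> sym_ideal"
    by (simp add: algebra_simps)
qed

instance
proof
  fix a b c :: "'a sym_alg"
  show "a + b + c = a + (b + c)" by transfer (simp add: add.assoc sym_ideal_zero)
  show "a + b = b + a" by transfer (simp add: add.commute sym_ideal_zero)
  show "0 + a = a" by transfer (simp add: sym_ideal_zero)
  show "- a + a = 0" by transfer (simp add: sym_ideal_zero)
  show "a - b = a + - b" by transfer (simp add: sym_ideal_zero)
  show "a * b * c = a * (b * c)" by transfer (simp add: mult.assoc sym_ideal_zero)
  show "a * b = b * a" by transfer (simp add: mult.commute sym_ideal_zero)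
  show "1 * a = a" by transfer (simp add: sym_ideal_zero)
  show "(a + b) * c = a * c + b * c" by transfer (simp add: distrib_right sym_ideal_zero)
  show "(0 :: 'a sym_alg) \<noteq> 1"
    by transfer (simp add: minus_one_notin_sym_ideal)
qed

end

lift_definition sym_gen :: "'v::real_vector \<Rightarrow> 'v sym_alg" is free_gen .

lift_definition sym_const :: "real \<Rightarrow> 'v::real_vector sym_alg" is free_const .

lemma sym_gen_add: "sym_gen (v + w) = sym_gen v + sym_gen w"
  by transfer (simp add: sym_ideal_add_rel flip: diff_diff_eq)

lemma sym_gen_scaleR: "sym_gen (r *\<^sub>R v) = sym_const r * sym_gen v"
  by transfer (rule sym_ideal_scale_rel)

text \<open>Functoriality: a linear map \<open>f\<close> induces the algebra homomorphism \<open>sym_map f\<close>.\<close>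

definition free_map :: "('v \<Rightarrow> 'w) \<Rightarrow> ('v multiset \<Rightarrow>\<^sub>0 real) \<Rightarrow> 'w multiset \<Rightarrow>\<^sub>0 real" where
  "free_map f p = (\<Sum>m\<in>Poly_Mapping.keys p. Poly_Mapping.single (image_mset f m) (Poly_Mapping.lookup p m))"

lemma free_map_superset:
  assumes "finite A" "Poly_Mapping.keys p \<subseteq> A"
  shows "free_map f p = (\<Sum>m\<in>A. Poly_Mapping.single (image_mset f m) (Poly_Mapping.lookup p m))"
  unfolding free_map_def
  by (rule sum.mono_neutral_left) (use assms in \<open>auto simp: in_keys_iff\<close>)

lemma free_map_zero [simp]: "free_map f 0 = 0"
  by (simp add: free_map_def)

lemma free_map_add: "free_map f (p + q) = free_map f p + free_map f q"
proof -
  let ?A = "Poly_Mapping.keys p \<union> Poly_Mapping.keys q"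
  have "Poly_Mapping.keys (p + q) \<subseteq> ?A" by (rule Poly_Mapping.keys_add)
  then show ?thesis
    by (simp add: free_map_superset[of ?A] lookup_add single_add sum.distrib)
qed

lemma free_map_uminus: "free_map f (- p) = - free_map f p"
  using free_map_add[of f p "- p"] by (simp add: eq_neg_iff_add_eq_0 add.commute)

lemma free_map_diff: "free_map f (p - q) = free_map f p - free_map f q"
  using free_map_add[of f p "- q"] by (simp add: free_map_uminus)

lemma free_map_single: "free_map f (Poly_Mapping.single m c) = Poly_Mapping.single (image_mset f m) c"
  by (cases "c = 0") (simp_all add: free_map_def)

lemma free_map_sum: "free_map f (sum g A) = (\<Sum>i\<in>A. free_map f (g i))"
  by (induction A rule: infinite_finite_induct) (simp_all add: free_map_add)

lemma free_sum_monomials: "p = (\<Sum>m\<in>Poly_Mapping.keys p. Poly_Mapping.single m (Poly_Mapping.lookup p m))"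
proof (rule poly_mapping_eqI)
  fix k
  show "Poly_Mapping.lookup p k = Poly_Mapping.lookup (\<Sum>m\<in>Poly_Mapping.keys p. Poly_Mapping.single m (Poly_Mapping.lookup p m)) k"
    by (simp add: lookup_sum lookup_single when_def in_keys_iff)
qed

lemma free_map_mult: "free_map f (p * q) = free_map f p * free_map f q"
proof -
  have "free_map f (p * q) = free_map f ((\<Sum>m\<in>Poly_Mapping.keys p. Poly_Mapping.single m (Poly_Mapping.lookup p m)) *
      (\<Sum>m\<in>Poly_Mapping.keys q. Poly_Mapping.single m (Poly_Mapping.lookup q m)))"
    using free_sum_monomials[of p] free_sum_monomials[of q] by simp
  also have "\<dots> = free_map f p * free_map f q"
    by (simp add: sum_product free_map_sum mult_single free_map_single)
      (simp add: free_map_def sum_product mult_single)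
  finally show ?thesis .
qed

lemma free_map_gen: "free_map f (free_gen v) = free_gen (f v)"
  by (simp add: free_gen_def free_map_single)

lemma free_map_const: "free_map f (free_const r) = free_const r"
  by (simp add: free_const_def free_map_single)

lemma free_map_sym_ideal:
  assumes "linear f" "p \<in> sym_ideal"
  shows "free_map f p \<in> sym_ideal"
  using assms(2)
proof (induction rule: sym_ideal.induct)
  case (sym_ideal_add_rel v w)
  then show ?case
    by (simp add: free_map_diff free_map_gen linear_add[OF assms(1)] sym_ideal.sym_ideal_add_rel)
next
  case (sym_ideal_scale_rel r v)
  then show ?case
    by (simp add: free_map_diff free_map_mult free_map_gen free_map_const
        linear_scale[OF assms(1)] sym_ideal.sym_ideal_scale_rel)
next
  case (sym_ideal_add p q)
  then show ?case by (simp add: free_map_add sym_ideal.sym_ideal_add)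
next
  case (sym_ideal_mult p s)
  then show ?case by (simp add: free_map_mult sym_ideal.sym_ideal_mult)
qed

lift_definition sym_map :: "('v::real_vector \<Rightarrow> 'w::real_vector) \<Rightarrow> 'v sym_alg \<Rightarrow> 'w sym_alg"
  is "\<lambda>f p. if linear f then free_map f p else 0"
  by (simp add: sym_ideal_zero free_map_sym_ideal flip: free_map_diff)

lemma sym_map_add: "sym_map f (x + y) = sym_map f x + sym_map f y"
  by transfer (simp add: free_map_add sym_ideal_zero)

lemma sym_map_mult: "sym_map f (x * y) = sym_map f x * sym_map f y"
  by transfer (simp add: free_map_mult sym_ideal_zero)

lemma sym_map_const: "linear f \<Longrightarrow> sym_map f (sym_const r) = sym_const r"
  by transfer (simp add: free_map_const sym_ideal_zero)

lemma sym_map_gen: "linear f \<Longrightarrow> sym_map f (sym_gen v) = sym_gen (f v)"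
  by transfer (simp add: free_map_gen sym_ideal_zero)

text \<open>
  The symmetric algebra of a subspace \<open>W\<close>, regarded as a subalgebra of the symmetric algebra of
  the whole space through the (injective) map induced by the inclusion: polynomial expressions in
  elements of \<open>W\<close>.
\<close>

definition sym_alg_on :: "'v::real_vector set \<Rightarrow> 'v sym_alg set" where
  "sym_alg_on W = {abs_sym_alg p | p. \<forall>m\<in>Poly_Mapping.keys p. set_mset m \<subseteq> W}"


section \<open>Abstract one-skeleta\<close>

text \<open>
  The dual of the vector space \<open>'g\<close> is \<open>'g \<Rightarrow>\<^sub>L real\<close>, all linear functionals being bounded in
  finite dimension.  The inner product of \<open>'g\<close> is never used.
\<close>

definition lin_indep_list :: "'a::real_vector list \<Rightarrow> bool" where
  "lin_indep_list vs \<longleftrightarrow> distinct vs \<and> independent (set vs)"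

definition annihilator :: "'g::euclidean_space set \<Rightarrow> ('g \<Rightarrow>\<^sub>L real) set" where
  "annihilator h = {\<beta>. \<forall>x\<in>h. blinfun_apply \<beta> x = 0}"

definition pre_annihilator :: "('g::euclidean_space \<Rightarrow>\<^sub>L real) set \<Rightarrow> 'g set" where
  "pre_annihilator S = {x. \<forall>\<beta>\<in>S. blinfun_apply \<beta> x = 0}"

text \<open>
  The arcs of \<open>G\<close> are the oriented edges, \<open>tail\<close> and \<open>head\<close> are the initial and the terminal
  vertex, and \<open>bar\<close> reverses the orientation.  The locale \<open>bidirected_digraph\<close> allows loops; these
  are excluded as soon as the graph carries a compatible function for a polarizing vector.
\<close>

locale abstract_one_skeleton = fin_digraph G + bidirected_digraph G bar
  for G :: "('v, 'e) pre_digraph" and bar :: "'e \<Rightarrow> 'e" +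
  fixes d :: nat
    and \<theta> :: "'e \<Rightarrow> 'e \<Rightarrow> 'e"
    and \<alpha> :: "'e \<Rightarrow> 'g::euclidean_space \<Rightarrow>\<^sub>L real"
  assumes valent: "p \<in> verts G \<Longrightarrow> out_degree G p = d"
    and connection_bij:
      "e \<in> arcs G \<Longrightarrow> bij_betw (\<theta> e) (out_arcs G (tail G e)) (out_arcs G (head G e))"
    and connection_inverse:
      "\<lbrakk>e \<in> arcs G; a \<in> out_arcs G (tail G e)\<rbrakk> \<Longrightarrow> \<theta> (bar e) (\<theta> e a) = a"
    and axial_pairwise_independent:
      "\<lbrakk>p \<in> verts G; a \<in> out_arcs G p; b \<in> out_arcs G p; a \<noteq> b\<rbrakk> \<Longrightarrow> lin_indep_list [\<alpha> a, \<alpha> b]"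
    and axial_reverse:
      "e \<in> arcs G \<Longrightarrow> \<exists>m m'. m > 0 \<and> m' > 0 \<and> m' *\<^sub>R \<alpha> (bar e) = - (m *\<^sub>R \<alpha> e)"
    and axial_connection:
      "\<lbrakk>e \<in> arcs G; a \<in> out_arcs G (tail G e)\<rbrakk>
        \<Longrightarrow> \<exists>l r. l > 0 \<and> \<alpha> (\<theta> e a) = l *\<^sub>R \<alpha> a + r *\<^sub>R \<alpha> e"

definition three_independent ::
    "('v, 'e) pre_digraph \<Rightarrow> ('e \<Rightarrow> 'g::euclidean_space \<Rightarrow>\<^sub>L real) \<Rightarrow> bool" where
  "three_independent G \<alpha> \<longleftrightarrow>
    (\<forall>p\<in>verts G. \<forall>a\<in>out_arcs G p. \<forall>b\<in>out_arcs G p. \<forall>c\<in>out_arcs G p.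
      distinct [a, b, c] \<longrightarrow> lin_indep_list [\<alpha> a, \<alpha> b, \<alpha> c])"

definition polarizing ::
    "('v, 'e) pre_digraph \<Rightarrow> ('e \<Rightarrow> 'g::euclidean_space \<Rightarrow>\<^sub>L real) \<Rightarrow> 'g set" where
  "polarizing G \<alpha> = {\<xi>. \<forall>e\<in>arcs G. blinfun_apply (\<alpha> e) \<xi> \<noteq> 0}"

definition vertex_index ::
    "('v, 'e) pre_digraph \<Rightarrow> ('e \<Rightarrow> 'g::euclidean_space \<Rightarrow>\<^sub>L real) \<Rightarrow> 'g \<Rightarrow> 'v \<Rightarrow> nat" where
  "vertex_index G \<alpha> \<xi> p = card {e \<in> out_arcs G p. blinfun_apply (\<alpha> e) \<xi> < 0}"

text \<open>\<open>betti G \<alpha> \<xi> i\<close> is \<open>b\<^sub>2\<^sub>i\<close>, computed with the polarizing vector \<open>\<xi>\<close>.\<close>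

definition betti ::
    "('v, 'e) pre_digraph \<Rightarrow> ('e \<Rightarrow> 'g::euclidean_space \<Rightarrow>\<^sub>L real) \<Rightarrow> 'g \<Rightarrow> nat \<Rightarrow> nat" where
  "betti G \<alpha> \<xi> i = card {p \<in> verts G. vertex_index G \<alpha> \<xi> p = i}"

definition xi_compatible ::
    "('v, 'e) pre_digraph \<Rightarrow> ('e \<Rightarrow> 'g::euclidean_space \<Rightarrow>\<^sub>L real) \<Rightarrow> 'g \<Rightarrow> ('v \<Rightarrow> real) \<Rightarrow> bool" where
  "xi_compatible G \<alpha> \<xi> \<phi> \<longleftrightarrow>
    (\<forall>e\<in>arcs G. blinfun_apply (\<alpha> e) \<xi> > 0 \<longrightarrow> \<phi> (head G e) > \<phi> (tail G e))"

definition contract_wedge ::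
    "'g::euclidean_space \<Rightarrow> ('g \<Rightarrow>\<^sub>L real) \<Rightarrow> ('g \<Rightarrow>\<^sub>L real) \<Rightarrow> 'g \<Rightarrow>\<^sub>L real" where
  "contract_wedge \<xi> \<beta> \<gamma> = blinfun_apply \<beta> \<xi> *\<^sub>R \<gamma> - blinfun_apply \<gamma> \<xi> *\<^sub>R \<beta>"

definition generic_vector ::
    "('v, 'e) pre_digraph \<Rightarrow> ('e \<Rightarrow> 'g::euclidean_space \<Rightarrow>\<^sub>L real) \<Rightarrow> 'g \<Rightarrow> bool" where
  "generic_vector G \<alpha> \<xi> \<longleftrightarrow>
    (\<forall>p\<in>verts G. \<forall>a\<in>out_arcs G p. \<forall>b\<in>out_arcs G p. \<forall>c\<in>out_arcs G p. \<forall>e\<in>out_arcs G p.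
      distinct [a, b, c, e] \<longrightarrow>
      lin_indep_list [contract_wedge \<xi> (\<alpha> a) (\<alpha> b), contract_wedge \<xi> (\<alpha> c) (\<alpha> e)])"

definition sub_skeleton ::
    "('v, 'e) pre_digraph \<Rightarrow> ('e \<Rightarrow> 'g::euclidean_space \<Rightarrow>\<^sub>L real) \<Rightarrow> 'g set \<Rightarrow> ('v, 'e) pre_digraph" where
  "sub_skeleton G \<alpha> h = G\<lparr>arcs := {e \<in> arcs G. \<alpha> e \<in> annihilator h}\<rparr>"

text \<open>
  Directed reachability describes connected components here: the arc sets to which this is applied
  are closed under reversal.
\<close>

definition component_of :: "('v, 'e) pre_digraph \<Rightarrow> 'v \<Rightarrow> ('v, 'e) pre_digraph" where
  "component_of H p = H \<restriction> {q. p \<rightarrow>\<^sup>*\<^bsub>H\<^esub> q}"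

text \<open>
  The components of \<open>sub_skeleton G \<alpha> h\<close> are themselves one-skeleta, so their Betti numbers do not
  depend on the vector (polarizing for the component) with which they are computed.
\<close>

definition noncyclic ::
    "('v, 'e) pre_digraph \<Rightarrow> ('e \<Rightarrow> 'g::euclidean_space \<Rightarrow>\<^sub>L real) \<Rightarrow> bool" where
  "noncyclic G \<alpha> \<longleftrightarrow>
    (\<exists>\<xi>\<in>polarizing G \<alpha>.
      acyclic {(tail G e, head G e) | e. e \<in> arcs G \<and> blinfun_apply (\<alpha> e) \<xi> > 0}) \<and>
    (\<forall>h. subspace h \<and> dim h + 2 = DIM('g) \<longrightarrow>
      (\<forall>p\<in>verts G. let C = component_of (sub_skeleton G \<alpha> h) p in
        \<forall>\<xi>\<in>polarizing C \<alpha>. betti C \<alpha> \<xi> 0 = 1))"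

text \<open>
  Elements of the cohomology ring are represented by extensional functions on the vertex set, and
  the ring operations are pointwise.
\<close>

definition cohomology ::
    "('v, 'e) pre_digraph \<Rightarrow> ('e \<Rightarrow> 'g::euclidean_space \<Rightarrow>\<^sub>L real)
      \<Rightarrow> ('v \<Rightarrow> ('g \<Rightarrow>\<^sub>L real) sym_alg) set" where
  "cohomology G \<alpha> = {f \<in> verts G \<rightarrow>\<^sub>E UNIV.
    \<forall>e\<in>arcs G. \<exists>x. f (tail G e) - f (head G e) = sym_gen (\<alpha> e) * x}"


section \<open>Reduction\<close>

text \<open>
  An unoriented edge crossing \<open>c\<close> is represented by its orientation \<open>e\<close> from the upper to the lower
  vertex.  Thus \<open>crossing\<close> is the vertex set of the reduced one-skeleton, \<open>tail G e\<close> is the upper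
  endpoint, and \<open>\<alpha> e\<close> is the value of the axial function on the downward orientation.
\<close>

definition crossing :: "('v, 'e) pre_digraph \<Rightarrow> ('v \<Rightarrow> real) \<Rightarrow> real \<Rightarrow> 'e set" where
  "crossing G \<phi> c = {e \<in> arcs G. \<phi> (head G e) < c \<and> c < \<phi> (tail G e)}"

text \<open>
  For \<open>e\<close> crossing \<open>c\<close>, each other arc \<open>a\<close> at the upper endpoint of \<open>e\<close> gives an edge of the reduced
  one-skeleton, from \<open>e\<close> to \<open>crossing_partner G \<alpha> \<phi> c e a\<close>.
\<close>

definition reduced_arcs_at :: "('v, 'e) pre_digraph \<Rightarrow> 'e \<Rightarrow> 'e set" where
  "reduced_arcs_at G e = out_arcs G (tail G e) - {e}"

definition crossing_partner ::
    "('v, 'e) pre_digraph \<Rightarrow> ('e \<Rightarrow> 'g::euclidean_space \<Rightarrow>\<^sub>L real) \<Rightarrow> ('v \<Rightarrow> real) \<Rightarrow> real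
      \<Rightarrow> 'e \<Rightarrow> 'e \<Rightarrow> 'e" where
  "crossing_partner G \<alpha> \<phi> c e a =
    (let h = pre_annihilator (span {\<alpha> e, \<alpha> a});
         C = component_of (sub_skeleton G \<alpha> h) (tail G e)
     in THE e'. e' \<in> crossing C \<phi> c \<and> e' \<noteq> e)"

text \<open>
  For \<open>\<eta>\<close> with \<open>\<eta>(\<xi>) \<noteq> 0\<close>, \<open>reduce_along \<xi> \<eta>\<close> is the quotient map by the line spanned by \<open>\<eta>\<close>
  followed by the inverse of the bijection from the annihilator of \<open>\<xi>\<close> to that quotient.
\<close>

definition reduce_along ::
    "'g::euclidean_space \<Rightarrow> ('g \<Rightarrow>\<^sub>L real) \<Rightarrow> ('g \<Rightarrow>\<^sub>L real) \<Rightarrow> 'g \<Rightarrow>\<^sub>L real" where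
  "reduce_along \<xi> \<eta> \<beta> = \<beta> - (blinfun_apply \<beta> \<xi> / blinfun_apply \<eta> \<xi>) *\<^sub>R \<eta>"

lemma reduce_along_unique:
  assumes "blinfun_apply \<eta> \<xi> \<noteq> 0"
  shows "\<gamma> = reduce_along \<xi> \<eta> \<beta> \<longleftrightarrow> \<gamma> \<in> annihilator {\<xi>} \<and> \<beta> - \<gamma> \<in> span {\<eta>}"
proof
  assume "\<gamma> = reduce_along \<xi> \<eta> \<beta>"
  then show "\<gamma> \<in> annihilator {\<xi>} \<and> \<beta> - \<gamma> \<in> span {\<eta>}"
    using assms
    by (auto simp: reduce_along_def annihilator_def blinfun.diff_left blinfun.scaleR_left span_breakdown_eq)
next
  assume *: "\<gamma> \<in> annihilator {\<xi>} \<and> \<beta> - \<gamma> \<in> span {\<eta>}"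
  then obtain k where k: "\<beta> - \<gamma> = k *\<^sub>R \<eta>"
    by (auto simp: span_breakdown_eq)
  then have "blinfun_apply (\<beta> - \<gamma>) \<xi> = k * blinfun_apply \<eta> \<xi>"
    by (simp add: blinfun.scaleR_left)
  with * assms have "k = blinfun_apply \<beta> \<xi> / blinfun_apply \<eta> \<xi>"
    by (simp add: annihilator_def blinfun.diff_left)
  with k show "\<gamma> = reduce_along \<xi> \<eta> \<beta>"
    by (simp add: reduce_along_def algebra_simps)
qed

lemma linear_reduce_along: "linear (reduce_along \<xi> \<eta>)"
  by (rule linearI)
    (simp_all add: reduce_along_def blinfun.add_left blinfun.scaleR_left add_divide_distrib algebra_simps)

definition reduced_axial ::
    "('e \<Rightarrow> 'g::euclidean_space \<Rightarrow>\<^sub>L real) \<Rightarrow> 'g \<Rightarrow> 'e \<Rightarrow> 'e \<Rightarrow> 'g \<Rightarrow>\<^sub>L real" where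
  "reduced_axial \<alpha> \<xi> e a =
    \<alpha> a - (blinfun_apply (\<alpha> a) \<xi> / blinfun_apply (\<alpha> e) \<xi>) *\<^sub>R \<alpha> e"

definition reduced_cohomology ::
    "('v, 'e) pre_digraph \<Rightarrow> ('e \<Rightarrow> 'g::euclidean_space \<Rightarrow>\<^sub>L real) \<Rightarrow> 'g \<Rightarrow> ('v \<Rightarrow> real) \<Rightarrow> real
      \<Rightarrow> ('e \<Rightarrow> ('g \<Rightarrow>\<^sub>L real) sym_alg) set" where
  "reduced_cohomology G \<alpha> \<xi> \<phi> c =
    {g \<in> crossing G \<phi> c \<rightarrow>\<^sub>E sym_alg_on (annihilator {\<xi>}).
      \<forall>e\<in>crossing G \<phi> c. \<forall>a\<in>reduced_arcs_at G e.
        \<exists>x\<in>sym_alg_on (annihilator {\<xi>}).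
          g e - g (crossing_partner G \<alpha> \<phi> c e a) = sym_gen (reduced_axial \<alpha> \<xi> e a) * x}"

definition kirwan_map ::
    "('v, 'e) pre_digraph \<Rightarrow> ('e \<Rightarrow> 'g::euclidean_space \<Rightarrow>\<^sub>L real) \<Rightarrow> 'g \<Rightarrow> ('v \<Rightarrow> real) \<Rightarrow> real
      \<Rightarrow> ('v \<Rightarrow> ('g \<Rightarrow>\<^sub>L real) sym_alg) \<Rightarrow> 'e \<Rightarrow> ('g \<Rightarrow>\<^sub>L real) sym_alg" where
  "kirwan_map G \<alpha> \<xi> \<phi> c f =
    (\<lambda>e\<in>crossing G \<phi> c. sym_map (reduce_along \<xi> (\<alpha> e)) (f (tail G e)))"

end

theory Submission
  imports Defs "HOL-Computational_Algebra.Polynomial"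
begin

text \<open>
  Write \<open>\<rho>\<^sub>e\<close> for the reduction of the symmetric algebra along \<open>\<alpha> e\<close>; a class on \<open>\<Gamma>\<close> is a
  function \<open>f\<close> with \<open>\<rho>\<^sub>e (f p) = \<rho>\<^sub>e (f q)\<close> for every edge \<open>e\<close> from \<open>p\<close> to \<open>q\<close>.  A class on the
  reduction at \<open>c\<close> prescribes \<open>\<rho>\<^sub>e (f p)\<close> on the edges crossing \<open>c\<close>, and \<open>f\<close> is built from these
  values vertex by vertex, moving the level up from \<open>c\<close> to the top and, symmetrically, down to
  the bottom.

  At the lowest vertex \<open>p\<close> above the level, \<open>f p\<close> has to reduce to given values along the downward
  edges at \<open>p\<close>.  This is a one-variable interpolation problem whose nodes have pairwise coprime
  differences by 3-independence, so pairwise congruences suffice for its solvability.  After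
  passing \<open>p\<close> the values on the crossing edges still satisfy all congruences.  Indeed the edges of a
  component of a plane \<open>W\<close> give congruences modulo one and the same linear form, the generator of
  the line \<open>W \<inter> \<xi>\<^sup>0\<close>, and since the component has only one minimum and one maximum, it meets each
  level in at most two edges.
\<close>

section \<open>Divisibility by linear forms in the symmetric algebra\<close>

lemma sym_const_0 [simp]: "sym_const 0 = 0"
  by transfer (simp add: free_const_def sym_ideal_zero)

lemma sym_const_1 [simp]: "sym_const 1 = 1"
  by transfer (simp add: free_const_def sym_ideal_zero single_one)

lemma sym_const_add: "sym_const (r + s) = sym_const r + sym_const s"
  by transfer (simp add: free_const_def single_add sym_ideal_zero)

lemma sym_const_mult: "sym_const (r * s) = sym_const r * sym_const s"
  by transfer (simp add: free_const_def mult_single sym_ideal_zero)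

lemma sym_gen_0 [simp]: "sym_gen 0 = 0"
  using sym_gen_scaleR[of 0 0] by simp

lemma sym_gen_diff: "sym_gen (v - w) = sym_gen v - sym_gen w"
  using sym_gen_add[of "v - w" w] by simp

lemma sym_map_diff: "sym_map f (x - y) = sym_map f x - sym_map f y"
  using sym_map_add[of f "x - y" y] by simp

lemma sym_map_prod:
  assumes "linear f"
  shows "sym_map f (\<Prod>i\<in>A. g i) = (\<Prod>i\<in>A. sym_map f (g i))"
  using sym_map_const[OF assms, of 1]
  by (induction A rule: infinite_finite_induct) (simp_all add: sym_map_mult)

lemma sym_gen_scaleR_dvd_iff:
  assumes "r \<noteq> 0"
  shows "sym_gen (r *\<^sub>R v) dvd x \<longleftrightarrow> sym_gen v dvd x"
proof
  show "sym_gen (r *\<^sub>R v) dvd x \<Longrightarrow> sym_gen v dvd x"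
    by (metis sym_gen_scaleR dvd_mult_right)
  assume "sym_gen v dvd x"
  moreover have "sym_gen v = sym_const (1 / r) * sym_gen (r *\<^sub>R v)"
    using assms by (simp flip: sym_gen_scaleR)
  ultimately show "sym_gen (r *\<^sub>R v) dvd x"
    by (metis dvd_mult dvd_refl dvd_trans)
qed

lemma abs_sym_alg_cases:
  obtains p where "x = abs_sym_alg p"
  by (metis Quotient_abs_rep[OF Quotient_sym_alg])

lemma free_poly_induct [case_names const gen add mult]:
  fixes p :: "'v multiset \<Rightarrow>\<^sub>0 real"
  assumes const: "\<And>r. P (free_const r)"
    and gen: "\<And>v. P (free_gen v)"
    and add: "\<And>p q. P p \<Longrightarrow> P q \<Longrightarrow> P (p + q)"
    and mult: "\<And>p q. P p \<Longrightarrow> P q \<Longrightarrow> P (p * q)"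
  shows "P p"
proof -
  have "P (Poly_Mapping.single m r)" for m r
  proof (induction m)
    case empty
    then show ?case using const[of r] by (simp add: free_const_def)
  next
    case (add v m)
    have "Poly_Mapping.single (add_mset v m) r = free_gen v * Poly_Mapping.single m r"
      by (simp add: free_gen_def mult_single)
    then show ?case using mult[OF gen add.IH] by simp
  qed
  moreover have "P 0" using const[of 0] by (simp add: free_const_def)
  ultimately have "P (\<Sum>m\<in>A. Poly_Mapping.single m (Poly_Mapping.lookup p m))" for A
    by (induction A rule: infinite_finite_induct) (auto intro: add)
  then show ?thesis
    using free_sum_monomials[of p] by metis
qed

lemma sym_alg_induct [case_names const gen add mult]:
  fixes x :: "'v::real_vector sym_alg"
  assumes "\<And>r. P (sym_const r)"
    and "\<And>v. P (sym_gen v)"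
    and "\<And>x y. P x \<Longrightarrow> P y \<Longrightarrow> P (x + y)"
    and "\<And>x y. P x \<Longrightarrow> P y \<Longrightarrow> P (x * y)"
  shows "P x"
proof (rule abs_sym_alg_cases[of x])
  fix p assume "x = abs_sym_alg p"
  moreover have "P (abs_sym_alg p)"
    by (induction p rule: free_poly_induct)
      (use assms in \<open>auto simp flip: sym_const.abs_eq sym_gen.abs_eq plus_sym_alg.abs_eq times_sym_alg.abs_eq\<close>)
  ultimately show ?thesis by simp
qed

section \<open>Universal property of the symmetric algebra\<close>

definition free_eval :: "(real \<Rightarrow> 'a::comm_ring_1) \<Rightarrow> ('v \<Rightarrow> 'a) \<Rightarrow> ('v multiset \<Rightarrow>\<^sub>0 real) \<Rightarrow> 'a" where
  "free_eval k h p = (\<Sum>m\<in>Poly_Mapping.keys p. k (Poly_Mapping.lookup p m) * (\<Prod>v\<in>#m. h v))"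

context
  fixes k :: "real \<Rightarrow> 'a::comm_ring_1" and h :: "'v::real_vector \<Rightarrow> 'a"
  assumes k_one: "k 1 = 1"
    and k_add: "\<And>r s. k (r + s) = k r + k s"
    and k_mult: "\<And>r s. k (r * s) = k r * k s"
    and h_add: "\<And>v w. h (v + w) = h v + h w"
    and h_scale: "\<And>r v. h (r *\<^sub>R v) = k r * h v"
begin

lemma free_eval_scalar_zero: "k 0 = 0"
  using k_add[of 0 0] by simp

lemma free_eval_superset:
  assumes "finite A" "Poly_Mapping.keys p \<subseteq> A"
  shows "free_eval k h p = (\<Sum>m\<in>A. k (Poly_Mapping.lookup p m) * (\<Prod>v\<in>#m. h v))"
  unfolding free_eval_def
  by (rule sum.mono_neutral_left) (use assms in \<open>auto simp: in_keys_iff free_eval_scalar_zero\<close>)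

lemma free_eval_add: "free_eval k h (p + q) = free_eval k h p + free_eval k h q"
proof -
  let ?A = "Poly_Mapping.keys p \<union> Poly_Mapping.keys q"
  have "Poly_Mapping.keys (p + q) \<subseteq> ?A" by (rule Poly_Mapping.keys_add)
  then show ?thesis
    by (simp add: free_eval_superset[of ?A] lookup_add k_add distrib_right sum.distrib)
qed

lemma free_eval_single: "free_eval k h (Poly_Mapping.single m r) = k r * (\<Prod>v\<in>#m. h v)"
  by (cases "r = 0") (simp_all add: free_eval_def free_eval_scalar_zero)

lemma free_eval_zero: "free_eval k h 0 = 0"
  by (simp add: free_eval_def)

lemma free_eval_sum: "free_eval k h (sum g A) = (\<Sum>i\<in>A. free_eval k h (g i))"
  by (induction A rule: infinite_finite_induct) (simp_all add: free_eval_add free_eval_zero)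

lemma free_eval_mult: "free_eval k h (p * q) = free_eval k h p * free_eval k h q"
proof -
  have "free_eval k h (p * q) = free_eval k h ((\<Sum>m\<in>Poly_Mapping.keys p. Poly_Mapping.single m (Poly_Mapping.lookup p m)) *
      (\<Sum>m\<in>Poly_Mapping.keys q. Poly_Mapping.single m (Poly_Mapping.lookup q m)))"
    using free_sum_monomials[of p] free_sum_monomials[of q] by simp
  also have "\<dots> = free_eval k h p * free_eval k h q"
    by (simp add: sum_product free_eval_sum mult_single free_eval_single)
      (simp add: free_eval_def sum_product k_mult mult_ac)
  finally show ?thesis .
qed

lemma free_eval_diff: "free_eval k h (p - q) = free_eval k h p - free_eval k h q"
  using free_eval_add[of "p - q" q] by simp

lemma free_eval_gen: "free_eval k h (free_gen v) = h v"
  by (simp add: free_gen_def free_eval_single k_one)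

lemma free_eval_const: "free_eval k h (free_const r) = k r"
  by (simp add: free_const_def free_eval_single)

lemma free_eval_sym_ideal: "p \<in> sym_ideal \<Longrightarrow> free_eval k h p = 0"
  by (induction rule: sym_ideal.induct)
    (simp_all add: free_eval_add free_eval_mult free_eval_diff free_eval_gen free_eval_const h_add h_scale)

text \<open>The target is only a commutative ring, so its scalars enter through the ring
  homomorphism \<open>k\<close>. \<open>F\<close> evaluates an arbitrary representative, which is
  legitimate because \<open>free_eval\<close> kills \<open>sym_ideal\<close>.\<close>

lemma sym_alg_universal:
  obtains F :: "'v sym_alg \<Rightarrow> 'a" where
    "\<And>x y. F (x + y) = F x + F y" "\<And>x y. F (x * y) = F x * F y"
    "\<And>r. F (sym_const r) = k r" "\<And>v. F (sym_gen v) = h v"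
proof
  define F where "F x = free_eval k h (rep_sym_alg x)" for x
  have F_abs: "F (abs_sym_alg p) = free_eval k h p" for p
  proof -
    have "rep_sym_alg (abs_sym_alg p) - p \<in> sym_ideal"
      by (rule Quotient_rep_abs[OF Quotient_sym_alg]) (simp add: sym_ideal_zero)
    then have "free_eval k h (rep_sym_alg (abs_sym_alg p) - p) = 0"
      by (rule free_eval_sym_ideal)
    then show ?thesis
      by (simp add: F_def free_eval_diff)
  qed
  show "F (x + y) = F x + F y" for x y
    by (rule abs_sym_alg_cases[of x]; rule abs_sym_alg_cases[of y])
      (simp add: plus_sym_alg.abs_eq F_abs free_eval_add)
  show "F (x * y) = F x * F y" for x y
    by (rule abs_sym_alg_cases[of x]; rule abs_sym_alg_cases[of y])
      (simp add: times_sym_alg.abs_eq F_abs free_eval_mult)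
  show "F (sym_const r) = k r" for r
    by (simp add: sym_const.abs_eq F_abs free_eval_const)
  show "F (sym_gen v) = h v" for v
    by (simp add: sym_gen.abs_eq F_abs free_eval_gen)
qed

end

text \<open>
  Splitting off the coordinate \<open>m\<close> embeds the symmetric algebra into the polynomials in one
  variable over itself, with \<open>m\<close> becoming the variable; multiplication by the variable only shifts
  coefficients.
\<close>

lemma sym_gen_dvd_cancel:
  fixes l m :: "'v::real_vector"
  assumes "l \<noteq> 0" "m \<notin> span {l}" "sym_gen l dvd sym_gen m * z"
  shows "sym_gen l dvd z"
proof -
  have "l \<noteq> m" using assms(2) by (auto simp: span_base)
  have "independent {m, l}"
    using assms by (simp add: independent_insert)
  \<comment> \<open>\<open>D\<close> is the coordinate along \<open>m\<close>; since it vanishes on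
    \<open>l\<close>, the embedding \<open>F\<close> below sends \<open>l\<close> to a constant
    polynomial.\<close>
  then obtain D :: "'v \<Rightarrow> real" where D: "linear D" "D m = 1" "D l = 0"
    using linear_independent_extend[of "{m, l}" "\<lambda>v. if v = m then 1 else 0 :: real"] \<open>l \<noteq> m\<close>
    by auto
  define k :: "real \<Rightarrow> 'v sym_alg poly" where "k r = [:sym_const r:]" for r
  define h where "h v = [:sym_gen (v - D v *\<^sub>R m), sym_const (D v):]" for v
  obtain F where F: "\<And>x y. F (x + y) = F x + F y" "\<And>x y. F (x * y) = F x * F y"
      "\<And>r. F (sym_const r) = k r" "\<And>v. F (sym_gen v) = h v"
  proof (rule sym_alg_universal[of k h])
    show "h (v + w) = h v + h w" for v w
      by (simp add: h_def linear_add[OF D(1)] sym_const_add algebra_simps flip: sym_gen_add)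
    show "h (r *\<^sub>R v) = k r * h v" for r v
      by (simp add: h_def k_def linear_scale[OF D(1)] sym_const_mult algebra_simps flip: sym_gen_scaleR)
  qed (auto simp: k_def sym_const_add sym_const_mult)
  \<comment> \<open>Substituting \<open>m\<close> for the variable undoes \<open>F\<close>, so
    divisibility of all coefficients carries back to \<open>z\<close>.\<close>
  have poly_F: "poly (F x) (sym_gen m) = x" for x
    by (induction x rule: sym_alg_induct)
      (simp_all add: F k_def h_def sym_gen_diff sym_gen_scaleR mult.commute)
  have "F (sym_gen m) = [:0, 1:]" "F (sym_gen l) = [:sym_gen l:]"
    using D by (simp_all add: F h_def)
  moreover obtain u where "sym_gen m * z = sym_gen l * u"
    using assms(3) by (auto simp: dvd_def)
  ultimately have "[:0, 1:] * F z = [:sym_gen l:] * F u"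
    using F(2) by metis
  then have "pCons 0 (F z) = smult (sym_gen l) (F u)" by simp
  then have "coeff (F z) i = sym_gen l * coeff (F u) (Suc i)" for i
    by (metis coeff_pCons_Suc coeff_smult)
  then have "sym_gen l dvd poly (F z) (sym_gen m)"
    by (auto simp: poly_altdef intro!: dvd_sum)
  then show ?thesis by (simp add: poly_F)
qed

text \<open>By \<open>sym_gen_dvd_cancel\<close> non-proportional linear forms behave as coprime: a
  new form dividing \<open>z\<close> can be moved past each earlier factor and hence divides the
  remaining cofactor.\<close>

lemma prod_sym_gen_dvd:
  assumes "finite A" "\<And>i. i \<in> A \<Longrightarrow> l i \<noteq> 0"
    and "\<And>i j. i \<in> A \<Longrightarrow> j \<in> A \<Longrightarrow> i \<noteq> j \<Longrightarrow> l i \<notin> span {l j}"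
    and "\<And>i. i \<in> A \<Longrightarrow> sym_gen (l i) dvd z"
  shows "(\<Prod>i\<in>A. sym_gen (l i)) dvd z"
  using assms
proof (induction A)
  case (insert k A)
  then obtain u where u: "z = (\<Prod>i\<in>A. sym_gen (l i)) * u"
    by (auto simp: dvd_def)
  have indep: "l k \<noteq> 0" "\<And>j. j \<in> A \<Longrightarrow> l j \<notin> span {l k}"
    using insert.hyps insert.prems by auto
  have "sym_gen (l k) dvd (\<Prod>i\<in>B. sym_gen (l i)) * u \<Longrightarrow> sym_gen (l k) dvd u"
    if "finite B" "B \<subseteq> A" for B
    using that
  proof (induction B)
    case (insert j B)
    have "sym_gen (l k) dvd (\<Prod>i\<in>B. sym_gen (l i)) * u"
    proof (rule sym_gen_dvd_cancel)
      show "l k \<noteq> 0" "l j \<notin> span {l k}"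
        using indep insert.prems by auto
      show "sym_gen (l k) dvd sym_gen (l j) * ((\<Prod>i\<in>B. sym_gen (l i)) * u)"
        using insert.prems insert.hyps by (simp add: mult_ac)
    qed
    then show ?case using insert by auto
  qed auto
  from this[of A] have "sym_gen (l k) dvd u"
    using insert.prems(3)[of k] insert.hyps(1) u by auto
  then show ?case
    using insert.hyps by (simp add: u mult.commute[of "sym_gen (l k)"] mult_dvd_mono)
qed auto


section \<open>Reduction and interpolation\<close>

lemma sym_map_ident: "sym_map (\<lambda>v. v) x = x"
  by (induction x rule: sym_alg_induct)
    (simp_all add: sym_map_const sym_map_gen sym_map_add sym_map_mult linear_ident)

text \<open>Congruence modulo \<open>s\<close> passes through sums and, by telescoping, through
  products, so checking generators suffices.\<close>

lemma dvd_sym_map_diff: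
  assumes "linear f" "linear g" "\<And>v. s dvd sym_gen (f v - g v)"
  shows "s dvd sym_map f x - sym_map g x"
proof (induction x rule: sym_alg_induct)
  case (const r)
  then show ?case using assms by (simp add: sym_map_const)
next
  case (gen v)
  then show ?case using assms by (simp add: sym_map_gen flip: sym_gen_diff)
next
  case (add x y)
  then have "s dvd (sym_map f x - sym_map g x) + (sym_map f y - sym_map g y)"
    by (rule dvd_add)
  then show ?case by (simp add: sym_map_add algebra_simps)
next
  case (mult x y)
  then have "s dvd (sym_map f x - sym_map g x) * sym_map f y + sym_map g x * (sym_map f y - sym_map g y)"
    by simp
  then show ?case by (simp add: sym_map_mult algebra_simps)
qed

lemma sym_const_uminus: "sym_const (- r) = - sym_const r"
  using sym_const_add[of "- r" r] by (simp add: eq_neg_iff_add_eq_0)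

section \<open>The symmetric algebra of a subspace\<close>

lemma sym_alg_on_const: "sym_const r \<in> sym_alg_on W"
  by (auto simp: sym_alg_on_def sym_const.abs_eq free_const_def in_keys_iff lookup_single when_def
      split: if_splits intro!: exI[of _ "free_const r"])

lemma sym_alg_on_gen: "v \<in> W \<Longrightarrow> sym_gen v \<in> sym_alg_on W"
  by (auto simp: sym_alg_on_def sym_gen.abs_eq free_gen_def in_keys_iff lookup_single when_def
      split: if_splits intro!: exI[of _ "free_gen v"])

lemma sym_alg_on_add:
  assumes "x \<in> sym_alg_on W" "y \<in> sym_alg_on W"
  shows "x + y \<in> sym_alg_on W"
proof -
  from assms obtain p q where "x = abs_sym_alg p" "y = abs_sym_alg q"
    "\<forall>m\<in>Poly_Mapping.keys p. set_mset m \<subseteq> W" "\<forall>m\<in>Poly_Mapping.keys q. set_mset m \<subseteq> W"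
    by (auto simp: sym_alg_on_def)
  then show ?thesis
    using Poly_Mapping.keys_add[of p q]
    by (auto simp: sym_alg_on_def plus_sym_alg.abs_eq intro!: exI[of _ "p + q"])
qed

lemma sym_alg_on_mult:
  assumes "x \<in> sym_alg_on W" "y \<in> sym_alg_on W"
  shows "x * y \<in> sym_alg_on W"
proof -
  from assms obtain p q where pq: "x = abs_sym_alg p" "y = abs_sym_alg q"
    "\<forall>m\<in>Poly_Mapping.keys p. set_mset m \<subseteq> W" "\<forall>m\<in>Poly_Mapping.keys q. set_mset m \<subseteq> W"
    by (auto simp: sym_alg_on_def)
  have "set_mset m \<subseteq> W" if m: "m \<in> Poly_Mapping.keys (p * q)" for m
  proof -
    obtain m1 m2 where "m = m1 + m2" "m1 \<in> Poly_Mapping.keys p" "m2 \<in> Poly_Mapping.keys q"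
      using m keys_mult[of p q] by blast
    then show ?thesis using pq by auto
  qed
  then show ?thesis
    unfolding sym_alg_on_def pq by (auto simp: times_sym_alg.abs_eq intro!: exI[of _ "p * q"])
qed

lemma sym_map_in_sym_alg_on:
  assumes "linear f" "range f \<subseteq> W"
  shows "sym_map f x \<in> sym_alg_on W"
proof (induction x rule: sym_alg_induct)
  case (gen v)
  have "f v \<in> W" using assms(2) by auto
  then show ?case using assms(1) by (simp add: sym_map_gen sym_alg_on_gen)
qed (use assms(1) in \<open>simp_all add: sym_map_const sym_map_add sym_map_mult sym_alg_on_const
      sym_alg_on_add sym_alg_on_mult\<close>)

lemma sym_map_fixes_sym_alg_on:
  assumes "linear f" "\<And>v. v \<in> W \<Longrightarrow> f v = v" "x \<in> sym_alg_on W"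
  shows "sym_map f x = x"
proof -
  from assms(3) obtain p where p: "x = abs_sym_alg p" "\<forall>m\<in>Poly_Mapping.keys p. set_mset m \<subseteq> W"
    by (auto simp: sym_alg_on_def)
  have "image_mset f m = m" if "m \<in> Poly_Mapping.keys p" for m
  proof -
    have "image_mset f m = image_mset (\<lambda>v. v) m"
      using p(2) that assms(2) by (intro image_mset_cong) blast
    then show ?thesis by simp
  qed
  then have "free_map f p = p"
    using free_sum_monomials[of p] by (simp add: free_map_def)
  then show ?thesis
    using assms(1) by (simp add: p(1) sym_map.abs_eq)
qed

section \<open>Reduction along a linear form\<close>

lemma reduce_along_self: "blinfun_apply \<eta> \<xi> \<noteq> 0 \<Longrightarrow> reduce_along \<xi> \<eta> \<eta> = 0"
  by (simp add: reduce_along_def)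

lemma reduce_along_ident: "\<beta> \<in> annihilator {\<xi>} \<Longrightarrow> reduce_along \<xi> \<eta> \<beta> = \<beta>"
  by (simp add: reduce_along_def annihilator_def)

lemma reduce_along_in_annihilator:
  "blinfun_apply \<eta> \<xi> \<noteq> 0 \<Longrightarrow> reduce_along \<xi> \<eta> \<beta> \<in> annihilator {\<xi>}"
  using reduce_along_unique[of \<eta> \<xi>] by blast

lemma reduce_along_scaleR: "r \<noteq> 0 \<Longrightarrow> reduce_along \<xi> (r *\<^sub>R \<eta>) = reduce_along \<xi> \<eta>"
  by (auto simp: reduce_along_def blinfun.scaleR_left)

lemma reduce_along_uminus: "reduce_along (- \<xi>) \<eta> = reduce_along \<xi> \<eta>"
  by (auto simp: reduce_along_def blinfun.minus_right)

lemma sym_map_reduce_along_in: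
  "blinfun_apply \<eta> \<xi> \<noteq> 0 \<Longrightarrow> sym_map (reduce_along \<xi> \<eta>) x \<in> sym_alg_on (annihilator {\<xi>})"
  by (rule sym_map_in_sym_alg_on) (auto simp: linear_reduce_along reduce_along_in_annihilator)

lemma sym_map_reduce_along_ident:
  "x \<in> sym_alg_on (annihilator {\<xi>}) \<Longrightarrow> sym_map (reduce_along \<xi> \<eta>) x = x"
  by (rule sym_map_fixes_sym_alg_on) (auto simp: linear_reduce_along reduce_along_ident)

text \<open>\<open>reduce_along\<close> kills \<eta> and changes each vector by a multiple of \<eta>
  only, so every element is congruent to its reduction. This turns the edge condition in
  \<open>cohomology\<close> into an equality of reductions.\<close>

lemma sym_map_reduce_along_eq_iff:
  assumes "blinfun_apply \<eta> \<xi> \<noteq> 0"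
  shows "sym_map (reduce_along \<xi> \<eta>) x = sym_map (reduce_along \<xi> \<eta>) y \<longleftrightarrow> sym_gen \<eta> dvd x - y"
proof
  have *: "sym_gen \<eta> dvd z - sym_map (reduce_along \<xi> \<eta>) z" for z
  proof -
    have "sym_gen \<eta> dvd sym_map (\<lambda>v. v) z - sym_map (reduce_along \<xi> \<eta>) z"
      by (rule dvd_sym_map_diff) (auto simp: linear_ident linear_reduce_along reduce_along_def sym_gen_scaleR)
    then show ?thesis by (simp add: sym_map_ident)
  qed
  assume "sym_map (reduce_along \<xi> \<eta>) x = sym_map (reduce_along \<xi> \<eta>) y"
  then show "sym_gen \<eta> dvd x - y"
    using *[of "x - y"] by (simp add: sym_map_diff)
next
  assume "sym_gen \<eta> dvd x - y"
  then obtain u where "x - y = sym_gen \<eta> * u" by (auto simp: dvd_def)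
  then have "sym_map (reduce_along \<xi> \<eta>) (x - y) = 0"
    using assms by (simp add: sym_map_mult sym_map_gen linear_reduce_along reduce_along_self)
  then show "sym_map (reduce_along \<xi> \<eta>) x = sym_map (reduce_along \<xi> \<eta>) y"
    by (simp add: sym_map_diff)
qed

text \<open>The projections along \<eta> and \<zeta> differ on each vector by a multiple of one
  fixed vector, and a congruence on generators extends to the algebra.\<close>

lemma reduce_along_dvd_sym_map_diff:
  assumes "blinfun_apply \<eta> \<xi> \<noteq> 0" "blinfun_apply \<zeta> \<xi> \<noteq> 0"
  shows "sym_gen (reduce_along \<xi> \<eta> \<zeta>)
    dvd sym_map (reduce_along \<xi> \<eta>) x - sym_map (reduce_along \<xi> \<zeta>) x"
proof (rule dvd_sym_map_diff)
  fix v
  have "reduce_along \<xi> \<eta> v - reduce_along \<xi> \<zeta> v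
      = (blinfun_apply v \<xi> / blinfun_apply \<zeta> \<xi>) *\<^sub>R reduce_along \<xi> \<eta> \<zeta>"
    using assms by (simp add: reduce_along_def algebra_simps)
  then show "sym_gen (reduce_along \<xi> \<eta> \<zeta>) dvd sym_gen (reduce_along \<xi> \<eta> v - reduce_along \<xi> \<zeta> v)"
    by (simp add: sym_gen_scaleR)
qed (auto simp: linear_reduce_along)

text \<open>Reduction along \<eta> is a retraction onto the subalgebra that fixes \<open>z\<close>
  and \<open>l\<close>; applied to any quotient it gives one inside the subalgebra, as
  \<open>reduced_cohomology\<close> demands.\<close>

lemma sym_alg_on_dvd:
  fixes \<eta> :: "'g::euclidean_space \<Rightarrow>\<^sub>L real"
  assumes "blinfun_apply \<eta> \<xi> \<noteq> 0" "l \<in> annihilator {\<xi>}" "z \<in> sym_alg_on (annihilator {\<xi>})"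
    and "sym_gen l dvd z"
  obtains u where "u \<in> sym_alg_on (annihilator {\<xi>})" "z = sym_gen l * u"
proof -
  let ?r = "sym_map (reduce_along \<xi> \<eta>)"
  obtain u where "z = sym_gen l * u" using assms(4) by (auto simp: dvd_def)
  then have "?r z = ?r (sym_gen l) * ?r u" by (simp add: sym_map_mult)
  then have "z = sym_gen l * ?r u"
    using assms(2,3) by (simp add: sym_map_reduce_along_ident sym_alg_on_gen)
  then show ?thesis
    using that sym_map_reduce_along_in[OF assms(1)] by blast
qed

text \<open>
  Newton interpolation: in a coordinate \<open>x\<close> with \<open>x(\<xi>) \<noteq> 0\<close>, reduction along \<open>\<eta> i\<close> evaluates
  \<open>x\<close> at a point of the annihilator of \<open>\<xi>\<close>, and the differences of these points are proportional to
  \<open>reduce_along \<xi> (\<eta> i) (\<eta> j)\<close>.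
\<close>

lemma reduce_along_interpolation:
  fixes \<eta> :: "'i \<Rightarrow> 'g::euclidean_space \<Rightarrow>\<^sub>L real"
  assumes "finite A"
    and "\<And>i. i \<in> A \<Longrightarrow> blinfun_apply (\<eta> i) \<xi> \<noteq> 0"
    and "\<And>i j k. i \<in> A \<Longrightarrow> j \<in> A \<Longrightarrow> k \<in> A \<Longrightarrow> i \<noteq> j \<Longrightarrow> i \<noteq> k \<Longrightarrow> \<eta> i \<notin> span {\<eta> j, \<eta> k}"
    and "\<And>i. i \<in> A \<Longrightarrow> y i \<in> sym_alg_on (annihilator {\<xi>})"
    and "\<And>i j. i \<in> A \<Longrightarrow> j \<in> A \<Longrightarrow> i \<noteq> j \<Longrightarrow> sym_gen (reduce_along \<xi> (\<eta> i) (\<eta> j)) dvd y i - y j"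
  shows "\<exists>F. \<forall>i\<in>A. sym_map (reduce_along \<xi> (\<eta> i)) F = y i"
  using assms
proof (induction A)
  case (insert k A)
  let ?r = "\<lambda>i. sym_map (reduce_along \<xi> (\<eta> i))"
  let ?l = "\<lambda>i. reduce_along \<xi> (\<eta> k) (\<eta> i)"
  have "\<exists>F. \<forall>i\<in>A. ?r i F = y i"
    by (rule insert.IH) (use insert.prems in \<open>simp_all\<close>)
  then obtain F where F: "\<forall>i\<in>A. ?r i F = y i" ..
  let ?z = "y k - ?r k F"
  \<comment> \<open>The error of \<open>F\<close> at the new node must be divisible by the product
    of all node differences for a Newton correction to exist.\<close>
  have "(\<Prod>i\<in>A. sym_gen (?l i)) dvd ?z"
  proof (rule prod_sym_gen_dvd)
    show "finite A" by fact
  next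
    fix i assume i: "i \<in> A"
    with insert.hyps have "k \<noteq> i" by auto
    show "?l i \<noteq> 0"
    proof
      assume "?l i = 0"
      then have "\<eta> i = (blinfun_apply (\<eta> i) \<xi> / blinfun_apply (\<eta> k) \<xi>) *\<^sub>R \<eta> k"
        by (simp add: reduce_along_def)
      then have "\<eta> i \<in> span {\<eta> k, \<eta> k}" by (metis insertI1 span_base span_scale)
      \<comment> \<open>With its last two indices equal, the hypothesis on triples expresses
        pairwise independence.\<close>
      then show False using insert.prems(2)[of i k k] i \<open>k \<noteq> i\<close> by auto
    qed
    \<comment> \<open>Since \<open>?r i F = y i\<close>, this sum telescopes to
      \<open>?z\<close>.\<close>
    have "sym_gen (?l i) dvd (y k - y i) + (?r i F - ?r k F)"
    proof (rule dvd_add)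
      show "sym_gen (?l i) dvd y k - y i"
        using insert.prems(4)[of k i] i \<open>k \<noteq> i\<close> by auto
      have "sym_gen (?l i) dvd - (?r k F - ?r i F)"
        unfolding dvd_minus_iff
        by (rule reduce_along_dvd_sym_map_diff) (use insert.prems(1) i in auto)
      then show "sym_gen (?l i) dvd ?r i F - ?r k F" by simp
    qed
    then show "sym_gen (?l i) dvd ?z" using F i by simp
  next
    fix i j assume ij: "i \<in> A" "j \<in> A" "i \<noteq> j"
    \<comment> \<open>Proportional node differences would put \<open>\<eta> i\<close> into the plane
      of \<open>\<eta> j\<close> and \<open>\<eta> k\<close>.\<close>
    show "?l i \<notin> span {?l j}"
    proof
      assume "?l i \<in> span {?l j}"
      then obtain t where "?l i = t *\<^sub>R ?l j" by (auto simp: span_breakdown_eq)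
      then have "\<eta> i = t *\<^sub>R \<eta> j + (blinfun_apply (\<eta> i) \<xi> / blinfun_apply (\<eta> k) \<xi>
          - t * (blinfun_apply (\<eta> j) \<xi> / blinfun_apply (\<eta> k) \<xi>)) *\<^sub>R \<eta> k"
        by (simp add: reduce_along_def algebra_simps)
      then have "\<eta> i \<in> span {\<eta> j, \<eta> k}"
        by (metis span_add span_scale span_base insertI1 insertI2)
      then show False using insert.prems(2)[of i j k] insert.hyps ij by auto
    qed
  qed
  then obtain u where u: "?z = (\<Prod>i\<in>A. sym_gen (?l i)) * u" by (auto simp: dvd_def)
  \<comment> \<open>The correction vanishes at every old node, where one factor reduces to 0; along
    \<open>\<eta> k\<close> its factors become the \<open>?l i\<close>, so it reduces to
    \<open>?z\<close>.\<close>
  let ?F = "F + (\<Prod>i\<in>A. sym_gen (\<eta> i)) * u"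
  have prod: "?r j (\<Prod>i\<in>A. sym_gen (\<eta> i)) = (\<Prod>i\<in>A. sym_gen (reduce_along \<xi> (\<eta> j) (\<eta> i)))" for j
    by (simp add: sym_map_prod linear_reduce_along sym_map_gen)
  have "?r j ?F = y j" if "j \<in> A" for j
  proof -
    have "?r j (\<Prod>i\<in>A. sym_gen (\<eta> i)) = 0"
      unfolding prod using insert.prems(1)[of j] insert.hyps(1) that
      by (intro prod_zero) (auto intro!: bexI[of _ j] simp: reduce_along_self)
    then show ?thesis using F that by (simp add: sym_map_add sym_map_mult)
  qed
  moreover have "?r k ?F = y k"
  proof -
    have "?r k ((\<Prod>i\<in>A. sym_gen (\<eta> i)) * u) = ?r k ?z"
      unfolding u by (simp add: sym_map_mult sym_map_prod linear_reduce_along sym_map_gen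
          reduce_along_ident reduce_along_in_annihilator insert.prems(1))
    also have "\<dots> = ?z"
      using insert.prems(1,3)[of k]
      by (simp add: sym_map_diff sym_map_reduce_along_ident sym_map_reduce_along_in)
    finally show ?thesis by (simp add: sym_map_add)
  qed
  ultimately have "\<forall>j\<in>insert k A. ?r j ?F = y j" by simp
  then show ?case by blast
qed auto


section \<open>Two-dimensional components\<close>

lemma span_pair_eq:
  fixes a b x y :: "'a::real_vector"
  assumes "x \<noteq> y" "independent {x, y}" "{x, y} \<subseteq> span {a, b}"
  shows "span {x, y} = span {a, b}"
proof (rule antisym)
  show "span {x, y} \<subseteq> span {a, b}"
    using assms(3) by (rule span_minimal) simp
  have "z \<in> span {x, y}" if z: "z \<in> {a, b}" for z
  proof (rule ccontr)
    assume "z \<notin> span {x, y}"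
    then have "independent {z, x, y}" "z \<notin> {x, y}"
      using assms(2) by (auto simp: independent_insert span_base)
    moreover have "{z, x, y} \<subseteq> span {a, b}"
      using assms(3) z by (auto simp: span_base)
    ultimately have "card {z, x, y} \<le> card {a, b}"
      using independent_span_bound[of "{a, b}" "{z, x, y}"] by simp
    moreover have "card {a, b} \<le> 2" by (simp add: card_insert_if)
    ultimately show False using assms(1) \<open>z \<notin> {x, y}\<close> by simp
  qed
  then show "span {a, b} \<subseteq> span {x, y}"
    by (intro span_minimal) auto
qed

lemma lin_indep_pair_iff:
  "lin_indep_list [v, w] \<longleftrightarrow> v \<noteq> w \<and> independent {v, w}"
  by (auto simp: lin_indep_list_def)

lemma linear_functional_eq_inner:
  fixes \<beta> :: "'g::euclidean_space \<Rightarrow>\<^sub>L real"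
  obtains b where "\<beta> = blinfun_inner_right b"
proof
  show "\<beta> = blinfun_inner_right (\<Sum>i\<in>Basis. blinfun_apply \<beta> i *\<^sub>R i)"
    by (rule blinfun_euclidean_eqI) (simp add: inner_sum_left inner_Basis if_distrib cong: if_cong)
qed

lemma linear_blinfun_inner_right: "linear (blinfun_inner_right :: 'g::euclidean_space \<Rightarrow> _)"
  by (rule bounded_linear.linear) (rule bounded_linear_blinfun_inner_right)

text \<open>Translates between planes of functionals, used below, and the codimension 2 subspaces in
  \<open>noncyclic\<close>. Representing functionals by inner products turns annihilators into
  orthogonal complements.\<close>

lemma
  fixes \<beta> \<gamma> :: "'g::euclidean_space \<Rightarrow>\<^sub>L real"
  assumes "\<beta> \<noteq> \<gamma>" "independent {\<beta>, \<gamma>}"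
  defines "h \<equiv> pre_annihilator (span {\<beta>, \<gamma>})"
  shows subspace_pre_annihilator_plane: "subspace h"
    and dim_pre_annihilator_plane: "dim h + 2 = DIM('g)"
    and annihilator_pre_annihilator_plane: "annihilator h = span {\<beta>, \<gamma>}"
proof -
  note T = linear_blinfun_inner_right[where 'g='g]
  obtain b c where bc: "\<beta> = blinfun_inner_right b" "\<gamma> = blinfun_inner_right c"
    by (metis linear_functional_eq_inner)
  have "b \<noteq> c" using assms(1) bc by auto
  have "b \<notin> span {c}"
  proof
    assume "b \<in> span {c}"
    then have "\<beta> \<in> span {\<gamma>}"
      using linear_span_image[OF T, of "{c}"] bc by auto
    then show False using assms(1,2) by (simp add: independent_insert)
  qed
  moreover have "c \<noteq> 0"
    using assms(2) bc linear_0[OF T] dependent_zero[of "{\<beta>, \<gamma>}"] by auto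
  ultimately have ind: "independent {b, c}"
    using \<open>b \<noteq> c\<close> by (simp add: independent_insert)
  have span_image: "span {\<beta>, \<gamma>} = blinfun_inner_right ` span {b, c}"
    using linear_span_image[OF T, of "{b, c}"] by (simp add: bc)
  have h: "h = (span {b, c})\<^sup>\<bottom>"
    unfolding h_def pre_annihilator_def span_image orthogonal_comp_def orthogonal_def
    by (auto simp: inner_commute)
  show "subspace h" unfolding h by (rule subspace_orthogonal_comp)
  have "dim {y \<in> UNIV. \<forall>x \<in> span {b, c}. orthogonal x y} + dim (span {b, c}) = dim (UNIV :: 'g set)"
    by (rule dim_subspace_orthogonal_to_vectors) auto
  moreover have "dim (span {b, c}) = 2"
    using ind \<open>b \<noteq> c\<close> by (simp add: dim_eq_card_independent)
  ultimately show "dim h + 2 = DIM('g)"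
    by (simp add: h orthogonal_comp_def)
  have "annihilator h = blinfun_inner_right ` (h\<^sup>\<bottom>)"
  proof (intro set_eqI iffI)
    fix \<delta> assume \<delta>: "\<delta> \<in> annihilator h"
    obtain d where "\<delta> = blinfun_inner_right d" by (metis linear_functional_eq_inner)
    with \<delta> show "\<delta> \<in> blinfun_inner_right ` (h\<^sup>\<bottom>)"
      by (auto simp: annihilator_def orthogonal_comp_def orthogonal_def inner_commute)
  next
    fix \<delta> assume "\<delta> \<in> blinfun_inner_right ` (h\<^sup>\<bottom>)"
    then show "\<delta> \<in> annihilator h"
      by (auto simp: annihilator_def orthogonal_comp_def orthogonal_def inner_commute)
  qed
  also have "\<dots> = span {\<beta>, \<gamma>}"
    by (simp add: h orthogonal_comp_self span_image)
  finally show "annihilator h = span {\<beta>, \<gamma>}" .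
qed

section \<open>Plane components of a polarized skeleton\<close>

locale polarized_skeleton = abstract_one_skeleton G bar d \<theta> \<alpha>
  for G :: "('v, 'e) pre_digraph" and bar :: "'e \<Rightarrow> 'e" and d :: nat
    and \<theta> :: "'e \<Rightarrow> 'e \<Rightarrow> 'e" and \<alpha> :: "'e \<Rightarrow> 'g::euclidean_space \<Rightarrow>\<^sub>L real" +
  fixes \<xi> :: 'g and \<phi> :: "'v \<Rightarrow> real"
  assumes three_indep: "three_independent G \<alpha>"
    and noncyc: "noncyclic G \<alpha>"
    and polarizing: "\<xi> \<in> polarizing G \<alpha>"
    and inj_\<phi>: "inj_on \<phi> (verts G)"
    and compatible: "xi_compatible G \<alpha> \<xi> \<phi>"
begin

lemma axial_apply_nonzero: "e \<in> arcs G \<Longrightarrow> blinfun_apply (\<alpha> e) \<xi> \<noteq> 0"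
  using polarizing by (simp add: polarizing_def)

lemma axial_bar:
  assumes "e \<in> arcs G"
  obtains r where "r > 0" "\<alpha> (bar e) = - r *\<^sub>R \<alpha> e"
proof -
  obtain m m' where m: "m > 0" "m' > 0" "m' *\<^sub>R \<alpha> (bar e) = - (m *\<^sub>R \<alpha> e)"
    using axial_reverse[OF assms] by blast
  have "\<alpha> (bar e) = (1 / m') *\<^sub>R (m' *\<^sub>R \<alpha> (bar e))" using m(2) by simp
  also have "\<dots> = - (m / m') *\<^sub>R \<alpha> e" unfolding m(3) by simp
  finally show ?thesis using m by (intro that[of "m / m'"]) auto
qed

lemma axial_bar_apply_less_iff:
  "e \<in> arcs G \<Longrightarrow> blinfun_apply (\<alpha> (bar e)) \<xi> < 0 \<longleftrightarrow> blinfun_apply (\<alpha> e) \<xi> > 0"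
  by (rule axial_bar[of e]) (auto simp: blinfun.scaleR_left blinfun.minus_left zero_less_mult_iff)

lemma axial_bar_apply_greater_iff:
  "e \<in> arcs G \<Longrightarrow> blinfun_apply (\<alpha> (bar e)) \<xi> > 0 \<longleftrightarrow> blinfun_apply (\<alpha> e) \<xi> < 0"
  using axial_bar_apply_less_iff[of "bar e"] by simp

lemma axial_bar_in_iff:
  assumes "e \<in> arcs G" "subspace W"
  shows "\<alpha> (bar e) \<in> W \<longleftrightarrow> \<alpha> e \<in> W"
proof -
  obtain r where r: "r > 0" "\<alpha> (bar e) = - r *\<^sub>R \<alpha> e" using axial_bar[OF assms(1)] .
  then have "\<alpha> e = (- 1 / r) *\<^sub>R \<alpha> (bar e)" by simp
  then show ?thesis using r(2) assms(2) by (metis subspace_scale)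
qed

lemma \<phi>_head_greater:
  "e \<in> arcs G \<Longrightarrow> blinfun_apply (\<alpha> e) \<xi> > 0 \<Longrightarrow> \<phi> (tail G e) < \<phi> (head G e)"
  using compatible by (simp add: xi_compatible_def)

lemma \<phi>_head_less:
  "e \<in> arcs G \<Longrightarrow> blinfun_apply (\<alpha> e) \<xi> < 0 \<Longrightarrow> \<phi> (head G e) < \<phi> (tail G e)"
  using \<phi>_head_greater[of "bar e"] by (simp add: axial_bar_apply_greater_iff)

lemma tail_neq_head: "e \<in> arcs G \<Longrightarrow> tail G e \<noteq> head G e"
  using \<phi>_head_less \<phi>_head_greater axial_apply_nonzero by (metis linorder_neqE order_less_irrefl)

text \<open>Components are indexed by planes \<open>W\<close> in the dual, since these are what
  pairs of edges span; \<open>component_of_sub_skeleton\<close> links them to components of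
  \<open>sub_skeleton\<close>.\<close>

definition plane_comp :: "('g \<Rightarrow>\<^sub>L real) set \<Rightarrow> 'v \<Rightarrow> 'v set" where
  "plane_comp W p = {q. (p, q) \<in> {(tail G b, head G b) | b. b \<in> arcs G \<and> \<alpha> b \<in> W}\<^sup>*}"

definition plane_at :: "('g \<Rightarrow>\<^sub>L real) set \<Rightarrow> 'v \<Rightarrow> 'e set" where
  "plane_at W q = {b \<in> out_arcs G q. \<alpha> b \<in> W}"

text \<open>The component of \<open>W\<close> through such a vertex is 2-valent there. The property
  spreads along the component, which is therefore a cycle.\<close>

definition plane_vertex :: "('g \<Rightarrow>\<^sub>L real) set \<Rightarrow> 'v \<Rightarrow> bool" where
  "plane_vertex W q \<longleftrightarrow> q \<in> verts G \<and>
    (\<exists>a b. a \<noteq> b \<and> plane_at W q = {a, b} \<and> W = span {\<alpha> a, \<alpha> b})"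

lemma plane_at_iff: "b \<in> plane_at W q \<longleftrightarrow> b \<in> arcs G \<and> tail G b = q \<and> \<alpha> b \<in> W"
  by (auto simp: plane_at_def)

lemma plane_comp_refl: "p \<in> plane_comp W p"
  by (simp add: plane_comp_def)

lemma plane_comp_step:
  "tail G b \<in> plane_comp W p \<Longrightarrow> b \<in> arcs G \<Longrightarrow> \<alpha> b \<in> W \<Longrightarrow> head G b \<in> plane_comp W p"
  unfolding plane_comp_def by (auto intro: rtrancl_into_rtrancl)

lemma plane_comp_induct [consumes 1, case_names base step]:
  assumes "q \<in> plane_comp W p" "P p"
    and "\<And>b. b \<in> arcs G \<Longrightarrow> \<alpha> b \<in> W \<Longrightarrow> tail G b \<in> plane_comp W p \<Longrightarrow> P (tail G b) \<Longrightarrow> P (head G b)"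
  shows "P q"
  using assms(1) unfolding plane_comp_def mem_Collect_eq
proof (induction rule: rtrancl_induct)
  case (step y z)
  then show ?case using assms(3) by (auto simp: plane_comp_def)
qed (rule assms(2))

lemma plane_comp_verts: "q \<in> plane_comp W p \<Longrightarrow> p \<in> verts G \<Longrightarrow> q \<in> verts G"
  by (induction rule: plane_comp_induct) auto

lemma finite_plane_comp: "p \<in> verts G \<Longrightarrow> finite (plane_comp W p)"
  by (rule finite_subset[OF _ finite_verts]) (auto intro: plane_comp_verts)

lemma plane_comp_eq:
  assumes "subspace W" "q \<in> plane_comp W p"
  shows "plane_comp W q = plane_comp W p"
proof -
  let ?R = "{(tail G b, head G b) | b. b \<in> arcs G \<and> \<alpha> b \<in> W}"
  have "sym ?R"
  proof (rule symI)
    fix x y assume "(x, y) \<in> ?R"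
    then obtain b where "b \<in> arcs G" "\<alpha> b \<in> W" "x = tail G b" "y = head G b" by auto
    then show "(y, x) \<in> ?R"
      using axial_bar_in_iff[OF _ assms(1)] by (auto intro!: exI[of _ "bar b"])
  qed
  then have "sym (?R\<^sup>*)" by (rule sym_rtrancl)
  moreover have "(p, q) \<in> ?R\<^sup>*" using assms(2) by (simp add: plane_comp_def)
  ultimately have "(q, p) \<in> ?R\<^sup>*" by (meson symD)
  with \<open>(p, q) \<in> ?R\<^sup>*\<close> show ?thesis
    unfolding plane_comp_def by (auto intro: rtrancl_trans)
qed

lemma plane_vertex_subspace: "plane_vertex W q \<Longrightarrow> subspace W"
  by (auto simp: plane_vertex_def)

lemma plane_vertex_card: "plane_vertex W q \<Longrightarrow> card (plane_at W q) = 2"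
  by (auto simp: plane_vertex_def card_2_iff)

lemma axial_pair_independent:
  assumes "e \<in> arcs G" "a \<in> out_arcs G (tail G e)" "a \<noteq> e"
  shows "\<alpha> e \<noteq> \<alpha> a" "independent {\<alpha> e, \<alpha> a}"
  using axial_pairwise_independent[of "tail G e" e a] assms by (auto simp: lin_indep_pair_iff)

lemma three_indep_notin_span:
  assumes "p \<in> verts G" "a \<in> out_arcs G p" "b \<in> out_arcs G p" "c \<in> out_arcs G p" "distinct [a, b, c]"
  shows "\<alpha> a \<notin> span {\<alpha> b, \<alpha> c}"
proof -
  have "lin_indep_list [\<alpha> a, \<alpha> b, \<alpha> c]"
    using three_indep assms unfolding three_independent_def by blast
  then show ?thesis
    by (simp add: lin_indep_list_def independent_insert)
qed

text \<open>By 3-independence no third edge at the vertex has its axial value in this plane.\<close>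

lemma plane_vertexI:
  assumes "e \<in> arcs G" "a \<in> out_arcs G (tail G e)" "a \<noteq> e"
  shows "plane_vertex (span {\<alpha> e, \<alpha> a}) (tail G e)"
proof -
  have "plane_at (span {\<alpha> e, \<alpha> a}) (tail G e) = {e, a}"
  proof (intro equalityI subsetI)
    fix b assume "b \<in> plane_at (span {\<alpha> e, \<alpha> a}) (tail G e)"
    then show "b \<in> {e, a}"
      using three_indep_notin_span[of "tail G e" b e a] assms by (auto simp: plane_at_def)
  qed (use assms in \<open>auto simp: plane_at_def span_base\<close>)
  then show ?thesis
    unfolding plane_vertex_def using assms by (metis wellformed(1))
qed

lemma plane_vertex_span:
  assumes "plane_vertex W q" "e \<in> plane_at W q" "a \<in> plane_at W q" "e \<noteq> a"
  shows "W = span {\<alpha> e, \<alpha> a}"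
  using assms by (auto simp: plane_vertex_def insert_commute)

lemma plane_vertex_other:
  assumes "plane_vertex W q" "e \<in> plane_at W q"
  obtains a where "a \<noteq> e" "plane_at W q = {e, a}"
  using assms unfolding plane_vertex_def by (metis insertE insert_commute singletonD)

text \<open>\<open>\<theta> b\<close> changes axial values by a positive factor and a multiple of
  \<open>\<alpha> b\<close>, which lies in \<open>W\<close>, so it matches the edges of
  \<open>W\<close> at the two ends of \<open>b\<close>. Two such edges are independent and again
  span \<open>W\<close>.\<close>

lemma plane_vertex_comp:
  assumes "q \<in> plane_comp W p" "plane_vertex W p"
  shows "plane_vertex W q"
  using assms
proof (induction rule: plane_comp_induct)
  case (step b)
  have W: "subspace W" using step plane_vertex_subspace by blast
  let ?p = "tail G b" and ?q = "head G b"
  have \<theta>: "bij_betw (\<theta> b) (out_arcs G ?p) (out_arcs G ?q)"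
    using connection_bij step by blast
  have W_iff: "\<alpha> (\<theta> b a) \<in> W \<longleftrightarrow> \<alpha> a \<in> W" if a: "a \<in> out_arcs G ?p" for a
  proof -
    obtain l r where lr: "l > 0" "\<alpha> (\<theta> b a) = l *\<^sub>R \<alpha> a + r *\<^sub>R \<alpha> b"
      using axial_connection[OF \<open>b \<in> arcs G\<close> a] by blast
    then have "\<alpha> a = (1 / l) *\<^sub>R (\<alpha> (\<theta> b a) - r *\<^sub>R \<alpha> b)" by simp
    with lr(2) show ?thesis
      using step W by (metis subspace_add subspace_diff subspace_scale)
  qed
  have "\<theta> b ` plane_at W ?p = plane_at W ?q"
    unfolding plane_at_def bij_betw_imp_surj_on[OF \<theta>, symmetric] using W_iff by blast
  moreover have "inj_on (\<theta> b) (plane_at W ?p)"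
    using \<theta> by (auto simp: plane_at_def bij_betw_def intro: inj_on_subset)
  ultimately have "card (plane_at W ?q) = 2"
    using step plane_vertex_card by (metis card_image)
  then obtain x y where xy: "x \<noteq> y" "plane_at W ?q = {x, y}" by (auto simp: card_2_iff)
  then have arcs: "x \<in> arcs G" "y \<in> arcs G" "tail G x = ?q" "tail G y = ?q" "\<alpha> x \<in> W" "\<alpha> y \<in> W"
    using plane_at_iff[of _ W ?q] by auto
  obtain a a' where "W = span {\<alpha> a, \<alpha> a'}" using step by (auto simp: plane_vertex_def)
  then have "W = span {\<alpha> x, \<alpha> y}"
    using span_pair_eq[of "\<alpha> x" "\<alpha> y" "\<alpha> a" "\<alpha> a'"] axial_pair_independent[of x y] arcs xy by auto
  then show ?case using xy step by (auto simp: plane_vertex_def)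
qed auto

section \<open>Minima, maxima and level crossings of plane components\<close>

definition plane_down :: "('g \<Rightarrow>\<^sub>L real) set \<Rightarrow> 'v \<Rightarrow> 'e set" where
  "plane_down W q = {b \<in> plane_at W q. blinfun_apply (\<alpha> b) \<xi> < 0}"

lemma component_of_sub_skeleton:
  fixes h :: "'g set"
  assumes "p \<in> verts G"
  defines "C \<equiv> component_of (sub_skeleton G \<alpha> h) p"
  shows "verts C = plane_comp (annihilator h) p"
    and "arcs C = {b \<in> arcs G. \<alpha> b \<in> annihilator h \<and> tail G b \<in> plane_comp (annihilator h) p}"
    and "tail C = tail G" "head C = head G"
proof -
  let ?H = "sub_skeleton G \<alpha> h" and ?W = "annihilator h"
  interpret H: wf_digraph ?H
    by unfold_locales (auto simp: sub_skeleton_def)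
  have "p \<rightarrow>\<^sup>*\<^bsub>?H\<^esub> q \<longleftrightarrow> q \<in> plane_comp ?W p" for q
  proof
    assume "p \<rightarrow>\<^sup>*\<^bsub>?H\<^esub> q"
    then show "q \<in> plane_comp ?W p"
    proof (induction rule: H.reachable_induct)
      case base
      show ?case by (rule plane_comp_refl)
    next
      case (step y z)
      then show ?case
        by (auto simp: sub_skeleton_def arcs_ends_def arc_to_ends_def intro: plane_comp_step)
    qed
  next
    assume "q \<in> plane_comp ?W p"
    then show "p \<rightarrow>\<^sup>*\<^bsub>?H\<^esub> q"
    proof (induction rule: plane_comp_induct)
      case base
      have "p \<in> verts ?H" using assms(1) by (simp add: sub_skeleton_def)
      then show ?case by (rule H.reachable_refl)
    next
      case (step b)
      then have "tail G b \<rightarrow>\<^bsub>?H\<^esub> head G b"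
        by (force simp: sub_skeleton_def arcs_ends_def arc_to_ends_def)
      with step show ?case by (meson H.reachable_adj_trans)
    qed
  qed
  then have *: "{q. p \<rightarrow>\<^sup>*\<^bsub>?H\<^esub> q} = plane_comp ?W p" by auto
  show "verts C = plane_comp ?W p" "tail C = tail G" "head C = head G"
    unfolding C_def component_of_def * by (auto simp: sub_skeleton_def)
  show "arcs C = {b \<in> arcs G. \<alpha> b \<in> ?W \<and> tail G b \<in> plane_comp ?W p}"
    unfolding C_def component_of_def *
    by (auto simp: sub_skeleton_def intro: plane_comp_step)
qed

text \<open>This is where noncyclicity enters: \<xi> is polarizing for the component, and a vertex
  of index 0 is one without downward arcs in \<open>W\<close>.\<close>

lemma unique_plane_min:
  assumes "plane_vertex W p"
  shows "card {q \<in> plane_comp W p. plane_down W q = {}} = 1"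
proof -
  obtain e where e: "e \<in> plane_at W p" using assms by (auto simp: plane_vertex_def)
  then obtain a where a: "a \<noteq> e" "plane_at W p = {e, a}" using plane_vertex_other[OF assms] by blast
  have p: "p \<in> verts G" using assms by (simp add: plane_vertex_def)
  have ea: "e \<in> arcs G" "tail G e = p" "a \<in> out_arcs G (tail G e)"
    using e a plane_at_iff[of e W p] plane_at_iff[of a W p] by auto
  have W: "W = span {\<alpha> e, \<alpha> a}" using plane_vertex_span[OF assms] a by auto
  define h where "h = pre_annihilator W"
  note ind = axial_pair_independent[OF ea(1,3) a(1)]
  have h: "subspace h" "dim h + 2 = DIM('g)" "annihilator h = W"
    using subspace_pre_annihilator_plane[OF ind] dim_pre_annihilator_plane[OF ind]
      annihilator_pre_annihilator_plane[OF ind] by (auto simp: h_def W)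
  define C where "C = component_of (sub_skeleton G \<alpha> h) p"
  note C = component_of_sub_skeleton[OF p, of h, folded C_def, unfolded h(3)]
  have "\<xi> \<in> polarizing C \<alpha>"
    using polarizing by (auto simp: polarizing_def C)
  then have "betti C \<alpha> \<xi> 0 = 1"
    using noncyc h p unfolding noncyclic_def Let_def C_def by blast
  moreover have "vertex_index C \<alpha> \<xi> q = 0 \<longleftrightarrow> plane_down W q = {}" if "q \<in> plane_comp W p" for q
  proof -
    have "{e \<in> out_arcs C q. blinfun_apply (\<alpha> e) \<xi> < 0} = plane_down W q"
      using that by (auto simp: plane_down_def plane_at_iff out_arcs_def C)
    moreover have "finite (plane_down W q)"
      by (auto simp: plane_down_def plane_at_def)
    ultimately show ?thesis by (simp add: vertex_index_def)
  qed
  then have "{q \<in> verts C. vertex_index C \<alpha> \<xi> q = 0} = {q \<in> plane_comp W p. plane_down W q = {}}"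
    by (auto simp: C)
  ultimately show ?thesis by (simp add: betti_def)
qed

text \<open>Extends \<open>crossing\<close> from levels to vertex sets, so that the cut can be
  pushed past one vertex at a time. For an upper set the arcs point downwards.\<close>

definition cut_arcs :: "'v set \<Rightarrow> 'e set" where
  "cut_arcs U = {e \<in> arcs G. tail G e \<in> U \<and> head G e \<notin> U}"

definition plane_cut :: "'v set \<Rightarrow> ('g \<Rightarrow>\<^sub>L real) set \<Rightarrow> 'v \<Rightarrow> 'e set" where
  "plane_cut U W p = {e \<in> cut_arcs U. \<alpha> e \<in> W \<and> tail G e \<in> plane_comp W p}"

definition upper_set :: "'v set \<Rightarrow> bool" where
  "upper_set U \<longleftrightarrow> U \<subseteq> verts G \<and> (\<forall>q\<in>U. \<forall>q'\<in>verts G. \<phi> q < \<phi> q' \<longrightarrow> q' \<in> U)"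

lemma upper_set_head:
  "upper_set U \<Longrightarrow> e \<in> arcs G \<Longrightarrow> tail G e \<in> U \<Longrightarrow> blinfun_apply (\<alpha> e) \<xi> > 0 \<Longrightarrow> head G e \<in> U"
  using \<phi>_head_greater by (auto simp: upper_set_def)

text \<open>
  The downward arcs of a component that start in \<open>U\<close> and do not leave it are the reversals of the
  upward ones, so the arcs leaving \<open>U\<close> are counted by downward minus upward valency.
\<close>

lemma card_plane_cut:
  assumes "plane_vertex W p" "upper_set U"
  defines "X \<equiv> plane_comp W p \<inter> U"
  shows "card (plane_cut U W p) + 2 * card {q \<in> X. card (plane_down W q) = 0}
    = 2 * card {q \<in> X. card (plane_down W q) = 2}"
proof -
  note W = plane_vertex_subspace[OF assms(1)]
  have "finite X"
    using finite_plane_comp[of p W] assms(1) by (simp add: X_def plane_vertex_def)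
  have fin_at: "finite (plane_at W q)" for q by (simp add: plane_at_def)
  define up where "up q = plane_at W q - plane_down W q" for q
  have up: "up q = {b \<in> plane_at W q. blinfun_apply (\<alpha> b) \<xi> > 0}" for q
    using axial_apply_nonzero by (force simp: up_def plane_down_def plane_at_iff)
  have two: "card (up q) = 2 - card (plane_down W q)" "card (plane_down W q) \<le> 2" if "q \<in> X" for q
  proof -
    have "card (plane_at W q) = 2"
      using plane_vertex_card plane_vertex_comp[OF _ assms(1)] that by (auto simp: X_def)
    moreover have "plane_down W q \<subseteq> plane_at W q" by (auto simp: plane_down_def)
    ultimately show "card (up q) = 2 - card (plane_down W q)" "card (plane_down W q) \<le> 2"
      using fin_at by (auto simp: up_def card_Diff_subset finite_subset dest: card_mono[rotated])
  qed
  define D where "D = (\<Union>q\<in>X. plane_down W q)"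
  define V where "V = (\<Union>q\<in>X. up q)"
  have cut_down: "plane_cut U W p \<subseteq> D"
    using upper_set_head[OF assms(2)] axial_apply_nonzero
    by (force simp: plane_cut_def cut_arcs_def D_def X_def plane_down_def plane_at_iff)
  have "D - plane_cut U W p = bar ` V"
  proof (intro equalityI subsetI)
    fix b assume "b \<in> D - plane_cut U W p"
    then have b: "b \<in> arcs G" "\<alpha> b \<in> W" "tail G b \<in> X" "blinfun_apply (\<alpha> b) \<xi> < 0" "head G b \<in> U"
      by (auto simp: D_def plane_down_def plane_at_iff X_def plane_cut_def cut_arcs_def)
    then have "bar b \<in> V"
      using plane_comp_step[of b W p]
      by (auto simp: V_def up plane_at_iff X_def axial_bar_in_iff[OF _ W] axial_bar_apply_greater_iff)
    then show "b \<in> bar ` V" by (metis arev_arev image_eqI)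
  next
    fix b assume "b \<in> bar ` V"
    then obtain c where c: "c \<in> arcs G" "\<alpha> c \<in> W" "tail G c \<in> X" "blinfun_apply (\<alpha> c) \<xi> > 0" "b = bar c"
      by (auto simp: V_def up plane_at_iff)
    then have "head G c \<in> X"
      using plane_comp_step[of c W p] upper_set_head[OF assms(2), of c] by (auto simp: X_def)
    with c show "b \<in> D - plane_cut U W p"
      by (auto simp: D_def plane_down_def plane_at_iff X_def plane_cut_def cut_arcs_def
          axial_bar_in_iff[OF _ W] axial_bar_apply_less_iff)
  qed
  moreover have "card (bar ` V) = card V"
    by (rule card_image) (metis arev_arev inj_onI)
  moreover have "finite D"
    using \<open>finite X\<close> fin_at by (auto simp: D_def plane_down_def)
  ultimately have "card D = card (plane_cut U W p) + card V"
    using cut_down by (metis card_Diff_subset card_mono finite_subset le_add_diff_inverse)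
  moreover have "card D = (\<Sum>q\<in>X. card (plane_down W q))"
    unfolding D_def
    by (rule card_UN_disjoint) (use \<open>finite X\<close> fin_at in \<open>auto simp: plane_down_def plane_at_iff\<close>)
  moreover have "card V = (\<Sum>q\<in>X. card (up q))"
    unfolding V_def
    by (rule card_UN_disjoint) (use \<open>finite X\<close> fin_at in \<open>auto simp: up plane_at_iff\<close>)
  \<comment> \<open>Upward and downward valency add up to 2 at each vertex, so they differ by 2 at a
    minimum or maximum and agree elsewhere.\<close>
  moreover have "(\<Sum>q\<in>X. card (plane_down W q)) + 2 * card {q \<in> X. card (plane_down W q) = 0}
      = (\<Sum>q\<in>X. card (up q)) + 2 * card {q \<in> X. card (plane_down W q) = 2}"
  proof -
    have "(\<Sum>q\<in>X. card (plane_down W q)) + 2 * card {q \<in> X. card (plane_down W q) = 0}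
        = (\<Sum>q\<in>X. card (plane_down W q) + (if card (plane_down W q) = 0 then 2 else 0))"
      using \<open>finite X\<close> by (simp add: sum.distrib sum.If_cases Int_def)
    also have "\<dots> = (\<Sum>q\<in>X. card (up q) + (if card (plane_down W q) = 2 then 2 else 0))"
    proof (rule sum.cong)
      fix q assume "q \<in> X"
      from two[OF this] have "card (plane_down W q) \<in> {0, 1, 2}" by auto
      then show "card (plane_down W q) + (if card (plane_down W q) = 0 then 2 else 0)
          = card (up q) + (if card (plane_down W q) = 2 then 2 else 0)"
        using two[OF \<open>q \<in> X\<close>] by auto
    qed simp
    also have "\<dots> = (\<Sum>q\<in>X. card (up q)) + 2 * card {q \<in> X. card (plane_down W q) = 2}"
      using \<open>finite X\<close> by (simp add: sum.distrib sum.If_cases Int_def)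
    finally show ?thesis .
  qed
  ultimately show ?thesis by linarith
qed

text \<open>The whole vertex set has empty cut, so the count gives as many maxima as minima, namely
  one. For general \<open>U\<close>, cut size plus twice the number of minima in \<open>U\<close> is
  then 0 or 2; a nonempty cut has two arcs and leaves no minimum in \<open>U\<close>.\<close>

lemma
  assumes "plane_vertex W p" "upper_set U" "e \<in> plane_cut U W p"
  shows plane_cut_card_2: "card (plane_cut U W p) = 2"
    and plane_down_nonempty: "q \<in> plane_comp W p \<Longrightarrow> q \<in> U \<Longrightarrow> plane_down W q \<noteq> {}"
proof -
  have p: "p \<in> verts G" using assms(1) by (simp add: plane_vertex_def)
  let ?X = "plane_comp W p"
  let ?S = "\<lambda>U k. {q \<in> ?X \<inter> U. card (plane_down W q) = k}"
  have fin: "finite (?S U k)" for U k using finite_plane_comp[OF p] by auto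
  have fin_down: "finite (plane_down W q)" for q by (simp add: plane_down_def plane_at_def)
  have "?X \<subseteq> verts G" using plane_comp_verts[OF _ p] by auto
  have "card (?S (verts G) 0) = 1"
    using unique_plane_min[OF assms(1)] fin_down \<open>?X \<subseteq> verts G\<close> by (simp add: Int_absorb2)
  moreover have "plane_cut (verts G) W p = {}" by (auto simp: plane_cut_def cut_arcs_def)
  ultimately have "card (?S (verts G) 2) = 1"
    using card_plane_cut[OF assms(1), of "verts G"] by (simp add: upper_set_def)
  then have "card (?S U 2) \<le> 1"
    using card_mono[OF fin[of "verts G" 2], of "?S U 2"] assms(2) by (auto simp: upper_set_def)
  moreover have "card (plane_cut U W p) > 0"
    using assms(3) by (auto simp: card_gt_0_iff plane_cut_def cut_arcs_def)
  moreover note card_plane_cut[OF assms(1,2)]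
  ultimately have "card (?S U 0) = 0" "card (plane_cut U W p) = 2" by presburger+
  then show "card (plane_cut U W p) = 2" by simp
  have "?S U 0 = {}" using fin[of U 0] \<open>card (?S U 0) = 0\<close> by simp
  then show "q \<in> plane_comp W p \<Longrightarrow> q \<in> U \<Longrightarrow> plane_down W q \<noteq> {}"
    using fin_down by auto
qed


section \<open>Extending classes across levels\<close>

abbreviation red :: "'e \<Rightarrow> ('g \<Rightarrow>\<^sub>L real) sym_alg \<Rightarrow> ('g \<Rightarrow>\<^sub>L real) sym_alg" where
  "red e \<equiv> sym_map (reduce_along \<xi> (\<alpha> e))"

text \<open>
  For a plane \<open>W\<close> containing an axial value, \<open>W \<inter> annihilator {\<xi>}\<close> is a line, so this is a single
  divisibility condition.
\<close>

definition plane_dvd :: "('g \<Rightarrow>\<^sub>L real) set \<Rightarrow> ('g \<Rightarrow>\<^sub>L real) sym_alg \<Rightarrow> bool" where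
  "plane_dvd W z \<longleftrightarrow> (\<forall>\<delta>\<in>W \<inter> annihilator {\<xi>}. \<delta> \<noteq> 0 \<longrightarrow> sym_gen \<delta> dvd z)"

lemma plane_dvd_0 [simp]: "plane_dvd W 0"
  by (simp add: plane_dvd_def)

lemma plane_dvd_trans: "plane_dvd W (x - y) \<Longrightarrow> plane_dvd W (y - z) \<Longrightarrow> plane_dvd W (x - z)"
  using dvd_add[of _ "x - y" "y - z"] by (simp add: plane_dvd_def)

lemma plane_dvd_sym: "plane_dvd W (x - y) \<Longrightarrow> plane_dvd W (y - x)"
  using dvd_minus_iff[of _ "x - y"] by (simp add: plane_dvd_def)

lemma red_bar: "e \<in> arcs G \<Longrightarrow> red (bar e) = red e"
  by (rule axial_bar[of e]) (auto simp: reduce_along_scaleR simp del: scaleR_minus_left)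

text \<open>The line is spanned by the reduced axial value, so \<open>plane_dvd\<close> is the
  congruence attached to an edge of the reduced skeleton.\<close>

lemma plane_dvd_span_iff:
  assumes "e \<in> arcs G" "a \<in> out_arcs G (tail G e)" "a \<noteq> e"
  shows "plane_dvd (span {\<alpha> e, \<alpha> a}) z \<longleftrightarrow> sym_gen (reduce_along \<xi> (\<alpha> e) (\<alpha> a)) dvd z"
proof
  let ?\<gamma> = "reduce_along \<xi> (\<alpha> e) (\<alpha> a)"
  have nz: "blinfun_apply (\<alpha> e) \<xi> \<noteq> 0" "blinfun_apply (\<alpha> a) \<xi> \<noteq> 0"
    using axial_apply_nonzero assms by auto
  show "sym_gen ?\<gamma> dvd z" if dvd: "plane_dvd (span {\<alpha> e, \<alpha> a}) z"
  proof -
    have "?\<gamma> \<in> span {\<alpha> e, \<alpha> a}"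
      unfolding reduce_along_def by (intro span_diff span_scale span_base) auto
    moreover have "?\<gamma> \<noteq> 0"
    proof
      assume "?\<gamma> = 0"
      then have "\<alpha> a \<in> span {\<alpha> e}"
        by (auto simp: reduce_along_def span_breakdown_eq)
      then show False
        using axial_pair_independent[OF assms] by (auto simp: insert_commute independent_insert)
    qed
    ultimately show ?thesis
      using dvd reduce_along_in_annihilator[OF nz(1)] by (auto simp: plane_dvd_def)
  qed
  show "plane_dvd (span {\<alpha> e, \<alpha> a}) z" if dvd: "sym_gen ?\<gamma> dvd z"
    unfolding plane_dvd_def
  proof (intro ballI impI)
    fix \<delta> assume \<delta>: "\<delta> \<in> span {\<alpha> e, \<alpha> a} \<inter> annihilator {\<xi>}" "\<delta> \<noteq> 0"
    then obtain s t where "\<delta> - s *\<^sub>R \<alpha> e = t *\<^sub>R \<alpha> a" by (auto simp: span_breakdown_eq)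
    then have st: "\<delta> = s *\<^sub>R \<alpha> e + t *\<^sub>R \<alpha> a" by (simp add: algebra_simps)
    \<comment> \<open>Vanishing at \<xi> fixes the ratio of the two coordinates of \<delta>.\<close>
    then have "s * blinfun_apply (\<alpha> e) \<xi> + t * blinfun_apply (\<alpha> a) \<xi> = 0"
      using \<delta>(1) by (auto simp: annihilator_def blinfun.add_left blinfun.scaleR_left)
    then have s: "s = - (t * (blinfun_apply (\<alpha> a) \<xi> / blinfun_apply (\<alpha> e) \<xi>))"
      using nz by (simp add: field_simps)
    then have "\<delta> = t *\<^sub>R ?\<gamma>"
      unfolding st by (simp add: reduce_along_def algebra_simps)
    moreover have "t \<noteq> 0" using \<delta>(2) s st by auto
    ultimately show "sym_gen \<delta> dvd z" using dvd by (simp add: sym_gen_scaleR_dvd_iff)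
  qed
qed

lemma plane_dvd_red_diff:
  assumes "plane_vertex W q" "e \<in> plane_at W q" "a \<in> plane_at W q"
  shows "plane_dvd W (red e x - red a x)"
proof (cases "e = a")
  case False
  have ea: "e \<in> arcs G" "a \<in> out_arcs G (tail G e)" "a \<noteq> e"
    using assms False by (auto simp: plane_at_iff)
  show ?thesis
    unfolding plane_vertex_span[OF assms False] plane_dvd_span_iff[OF ea]
    by (rule reduce_along_dvd_sym_map_diff) (use axial_apply_nonzero ea in auto)
qed simp

text \<open>Phrased by plane components instead of partner edges, the congruences make sense for
  every cut and pass through a vertex by transitivity.\<close>

definition compatible_on_cut :: "'v set \<Rightarrow> ('e \<Rightarrow> ('g \<Rightarrow>\<^sub>L real) sym_alg) \<Rightarrow> bool" where
  "compatible_on_cut U y \<longleftrightarrow> (\<forall>W p. plane_vertex W p \<longrightarrow>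
    (\<forall>e\<in>plane_cut U W p. \<forall>e'\<in>plane_cut U W p. plane_dvd W (y e - y e')))"

text \<open>Two cut arcs at \<open>p\<close> lie in a common plane component through
  \<open>p\<close>, so compatibility supplies exactly the pairwise congruences needed for
  interpolation.\<close>

lemma interpolation_at_vertex:
  assumes "upper_set U" "compatible_on_cut U y" "p \<in> U"
    and "\<And>e. e \<in> cut_arcs U \<Longrightarrow> y e \<in> sym_alg_on (annihilator {\<xi>})"
  shows "\<exists>F. \<forall>e \<in> cut_arcs U \<inter> out_arcs G p. red e F = y e"
proof (rule reduce_along_interpolation)
  show "finite (cut_arcs U \<inter> out_arcs G p)"
    by (rule finite_subset[OF _ finite_out_arcs]) auto
  have p: "p \<in> verts G" using assms by (auto simp: upper_set_def)
  let ?A = "cut_arcs U \<inter> out_arcs G p"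
  show "blinfun_apply (\<alpha> e) \<xi> \<noteq> 0" if "e \<in> ?A" for e
    using that axial_apply_nonzero by auto
  show "y e \<in> sym_alg_on (annihilator {\<xi>})" if "e \<in> ?A" for e
    using that assms(4) by auto
  show "\<alpha> i \<notin> span {\<alpha> j, \<alpha> k}" if "i \<in> ?A" "j \<in> ?A" "k \<in> ?A" "i \<noteq> j" "i \<noteq> k" for i j k
  proof (cases "j = k")
    case False
    then show ?thesis using three_indep_notin_span[OF p, of i j k] that by auto
  next
    case True
    then show ?thesis
      using axial_pair_independent[of i j] that by (auto simp: independent_insert)
  qed
  show "sym_gen (reduce_along \<xi> (\<alpha> i) (\<alpha> j)) dvd y i - y j" if ij: "i \<in> ?A" "j \<in> ?A" "i \<noteq> j" for i j
  proof -
    have *: "i \<in> arcs G" "j \<in> out_arcs G (tail G i)" "j \<noteq> i" "tail G i = p" using ij by auto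
    have "i \<in> plane_cut U (span {\<alpha> i, \<alpha> j}) p" "j \<in> plane_cut U (span {\<alpha> i, \<alpha> j}) p"
      using ij by (auto simp: plane_cut_def span_base plane_comp_refl)
    then have "plane_dvd (span {\<alpha> i, \<alpha> j}) (y i - y j)"
      using assms(2) plane_vertexI[OF *(1-3)] *(4) by (auto simp: compatible_on_cut_def)
    then show ?thesis using plane_dvd_span_iff[OF *(1-3)] by simp
  qed
qed

text \<open>
  When a plane component enters a new lowest vertex \<open>p\<close> from above and still meets the cut elsewhere,
  \<open>p\<close> is not its minimum, so the component leaves \<open>p\<close> downwards through the old cut.
\<close>

lemma compatible_on_cut_remove_lowest:
  assumes U: "upper_set U" and y: "compatible_on_cut U y"
    and p: "p \<in> U" "\<And>q. q \<in> U \<Longrightarrow> \<phi> p \<le> \<phi> q"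
    and F: "\<And>e. e \<in> cut_arcs U \<inter> out_arcs G p \<Longrightarrow> red e F = y e"
  shows "compatible_on_cut (U - {p}) (\<lambda>e. if head G e = p then red e F else y e)"
  unfolding compatible_on_cut_def
proof (intro allI impI ballI)
  let ?U = "U - {p}" and ?y = "\<lambda>e. if head G e = p then red e F else y e"
  fix W p0 e e'
  assume W: "plane_vertex W p0" and e: "e \<in> plane_cut ?U W p0" and e': "e' \<in> plane_cut ?U W p0"
  note sub = plane_vertex_subspace[OF W]
  have old: "b \<in> plane_cut U W p0" if "b \<in> plane_cut ?U W p0" "head G b \<noteq> p" for b
    using that by (auto simp: plane_cut_def cut_arcs_def)
  \<comment> \<open>The arcs gained by the cut are those ending at \<open>p\<close>; their reversals
    leave \<open>p\<close> upwards inside the component.\<close>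
  have at_p: "bar b \<in> plane_at W p" "b \<in> arcs G" "p \<in> plane_comp W p0" "\<phi> p < \<phi> (tail G b)"
    if "b \<in> plane_cut ?U W p0" "head G b = p" for b
  proof -
    show "b \<in> arcs G" "bar b \<in> plane_at W p" "p \<in> plane_comp W p0"
      using that plane_comp_step[of b W p0]
      by (auto simp: plane_cut_def cut_arcs_def plane_at_iff axial_bar_in_iff[OF _ sub])
    have "tail G b \<in> U" "tail G b \<noteq> p"
      using that by (auto simp: plane_cut_def cut_arcs_def)
    then have "\<phi> (tail G b) \<noteq> \<phi> p"
      using inj_\<phi> U p(1) by (auto simp: upper_set_def dest: inj_onD)
    then show "\<phi> p < \<phi> (tail G b)" using p(2)[OF \<open>tail G b \<in> U\<close>] by linarith
  qed
  have mixed: "plane_dvd W (?y b - ?y b')"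
    if b: "b \<in> plane_cut ?U W p0" "head G b = p" and b': "b' \<in> plane_cut ?U W p0" "head G b' \<noteq> p"
    for b b'
  proof -
    note b_at = at_p[OF b]
    obtain a where "a \<in> plane_down W p"
      using plane_down_nonempty[OF W U old[OF b'] b_at(3) p(1)] by auto
    then have a: "a \<in> plane_at W p" "blinfun_apply (\<alpha> a) \<xi> < 0" "a \<in> arcs G" "tail G a = p" "\<alpha> a \<in> W"
      by (auto simp: plane_down_def plane_at_iff)
    \<comment> \<open>A downward arc at the lowest vertex leaves \<open>U\<close>, so
      \<open>a\<close> carries an old value \<open>y a\<close>, which \<open>F\<close>
      reproduces.\<close>
    then have "head G a \<notin> U" using \<phi>_head_less[of a] p(2)[of "head G a"] by auto
    then have a_cut: "a \<in> cut_arcs U \<inter> out_arcs G p" "a \<in> plane_cut U W p0"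
      using a p(1) b_at(3) by (auto simp: cut_arcs_def plane_cut_def)
    then have "plane_dvd W (red a F - y b')"
      using F[of a] y W old[OF b'] by (auto simp: compatible_on_cut_def)
    moreover have "plane_dvd W (red (bar b) F - red a F)"
      using plane_vertex_comp[OF b_at(3) W] b_at(1) a(1) by (rule plane_dvd_red_diff)
    ultimately show ?thesis
      using b b' b_at(2) plane_dvd_trans by (auto simp: red_bar)
  qed
  show "plane_dvd W (?y e - ?y e')"
  proof (cases "head G e = p"; cases "head G e' = p")
    assume h: "head G e = p" "head G e' = p"
    then have "plane_dvd W (red (bar e) F - red (bar e') F)"
      using plane_dvd_red_diff[OF plane_vertex_comp[OF at_p(3)[OF e] W]] at_p[OF e] at_p[OF e'] by auto
    then show ?thesis using h at_p[OF e] at_p[OF e'] by (simp add: red_bar)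
  next
    assume h: "head G e = p" "head G e' \<noteq> p"
    show ?thesis using mixed[OF e h(1) e' h(2)] .
  next
    assume h: "head G e \<noteq> p" "head G e' = p"
    show ?thesis using mixed[OF e' h(2) e h(1)] by (rule plane_dvd_sym)
  next
    assume h: "head G e \<noteq> p" "head G e' \<noteq> p"
    then show ?thesis using y W old[OF e] old[OF e'] by (auto simp: compatible_on_cut_def)
  qed
qed

text \<open>After \<open>F\<close> is chosen at the lowest vertex \<open>p\<close>, the arcs ending
  at \<open>p\<close> join the cut with prescribed value \<open>red e F\<close>. Hence
  \<open>y\<close> varies in the induction, and the extension over \<open>U - {p}\<close>
  automatically matches \<open>F\<close>.\<close>

lemma extension_from_cut:
  assumes "upper_set U" "compatible_on_cut U y"
    and "\<And>e. e \<in> cut_arcs U \<Longrightarrow> y e \<in> sym_alg_on (annihilator {\<xi>})"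
  shows "\<exists>f. \<forall>e\<in>arcs G. tail G e \<in> U \<longrightarrow>
    red e (f (tail G e)) = (if head G e \<in> U then red e (f (head G e)) else y e)"
proof -
  have "finite U"
    by (rule finite_subset[OF _ finite_verts]) (use assms(1) in \<open>auto simp: upper_set_def\<close>)
  then show ?thesis
    using assms
  proof (induction U arbitrary: y rule: finite_psubset_induct)
    case (psubset U)
    note U = psubset.prems(1)
    show ?case
    proof (cases "U = {}")
      case False
      obtain p where p: "p \<in> U" "\<And>q. q \<in> U \<Longrightarrow> \<phi> p \<le> \<phi> q"
        using ex_is_arg_min_if_finite[OF \<open>finite U\<close> False, of \<phi>] by (auto simp: is_arg_min_linorder)
      obtain F where F: "\<And>e. e \<in> cut_arcs U \<inter> out_arcs G p \<Longrightarrow> red e F = y e"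
        using interpolation_at_vertex[OF U psubset.prems(2) p(1) psubset.prems(3)] by blast
      let ?U = "U - {p}" and ?y = "\<lambda>e. if head G e = p then red e F else y e"
      have "upper_set ?U"
        using U p by (fastforce simp: upper_set_def)
      moreover have "compatible_on_cut ?U ?y"
        using compatible_on_cut_remove_lowest[OF U psubset.prems(2) p F] by blast
      moreover have "?y e \<in> sym_alg_on (annihilator {\<xi>})" if "e \<in> cut_arcs ?U" for e
        using that psubset.prems(3)[of e] axial_apply_nonzero[of e]
        by (auto simp: cut_arcs_def intro: sym_map_reduce_along_in)
      ultimately obtain f where f: "\<And>e. e \<in> arcs G \<Longrightarrow> tail G e \<in> ?U \<Longrightarrow>
          red e (f (tail G e)) = (if head G e \<in> ?U then red e (f (head G e)) else ?y e)"
        using psubset.IH[of ?U ?y] p(1) by blast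
      have "red e ((f(p := F)) (tail G e))
          = (if head G e \<in> U then red e ((f(p := F)) (head G e)) else y e)"
        if e: "e \<in> arcs G" "tail G e \<in> U" for e
      proof (cases "tail G e = p")
        case True
        show ?thesis
        proof (cases "head G e \<in> U")
          case True
          \<comment> \<open>An arc from \<open>p\<close> into \<open>U\<close> is treated through
            its reversal, which belongs to the new cut.\<close>
          then have "red (bar e) (f (head G e)) = red (bar e) F"
            using f[of "bar e"] e \<open>tail G e = p\<close> tail_neq_head[OF e(1)] by auto
          then show ?thesis
            using True e \<open>tail G e = p\<close> tail_neq_head[OF e(1)] by (auto simp: red_bar)
        next
          case False
          then show ?thesis using F[of e] e True by (auto simp: cut_arcs_def)
        qed
      next
        case False
        then show ?thesis
          using f[of e] e p(1) by auto
      qed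
      then show ?thesis by blast
    qed auto
  qed
qed

section \<open>The Kirwan map at a regular level\<close>

lemma upper_set_superlevel: "upper_set {q \<in> verts G. c < \<phi> q}"
  by (auto simp: upper_set_def)

lemma crossing_eq_cut:
  assumes "c \<notin> \<phi> ` verts G"
  shows "crossing G \<phi> c = cut_arcs {q \<in> verts G. c < \<phi> q}"
proof -
  have "\<phi> q < c \<longleftrightarrow> \<not> c < \<phi> q" if "q \<in> verts G" for q
    using that assms by (metis image_eqI linorder_neqE not_less_iff_gr_or_eq)
  then show ?thesis by (auto simp: crossing_def cut_arcs_def)
qed

text \<open>The component crosses the level in exactly two arcs, one of them \<open>e\<close>, so
  the definite description in \<open>crossing_partner\<close> denotes the other.\<close>

lemma plane_cut_crossing_partner:
  assumes "c \<notin> \<phi> ` verts G" "e \<in> crossing G \<phi> c" "a \<in> reduced_arcs_at G e"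
  defines "W \<equiv> span {\<alpha> e, \<alpha> a}"
  defines "e' \<equiv> crossing_partner G \<alpha> \<phi> c e a"
  shows "plane_cut {q \<in> verts G. c < \<phi> q} W (tail G e) = {e, e'}"
proof -
  let ?U = "{q \<in> verts G. c < \<phi> q}" and ?p = "tail G e"
  have ea: "e \<in> arcs G" "a \<in> out_arcs G (tail G e)" "a \<noteq> e"
    using assms(2,3) by (auto simp: crossing_def reduced_arcs_at_def)
  have p: "?p \<in> verts G" using ea(1) by simp
  have e: "e \<in> plane_cut ?U W ?p"
    using assms(2) by (auto simp: crossing_eq_cut[OF assms(1)] plane_cut_def W_def span_base plane_comp_refl)
  have "card (plane_cut ?U W ?p) = 2"
    using plane_cut_card_2[OF plane_vertexI[OF ea, folded W_def] upper_set_superlevel e] .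
  then obtain e1 where e1: "plane_cut ?U W ?p = {e, e1}" "e1 \<noteq> e"
    using e unfolding card_2_iff by (metis insertE insert_commute singletonD)
  define h where "h = pre_annihilator W"
  have h: "annihilator h = W"
    using annihilator_pre_annihilator_plane[OF axial_pair_independent[OF ea]] by (simp add: h_def W_def)
  define C where "C = component_of (sub_skeleton G \<alpha> h) ?p"
  note C = component_of_sub_skeleton[OF p, of h, folded C_def, unfolded h]
  have "crossing C \<phi> c = plane_cut ?U W ?p"
    using crossing_eq_cut[OF assms(1)] by (auto simp: crossing_def plane_cut_def C)
  then have "(b \<in> crossing C \<phi> c \<and> b \<noteq> e) \<longleftrightarrow> b = e1" for b
    using e1 by auto
  then have "e' = e1"
    by (simp add: e'_def crossing_partner_def Let_def flip: W_def h_def C_def)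
  with e1 show ?thesis by auto
qed

lemma cohomology_red_eq:
  assumes "f \<in> cohomology G \<alpha>" "e \<in> arcs G"
  shows "red e (f (tail G e)) = red e (f (head G e))"
  using assms sym_map_reduce_along_eq_iff[OF axial_apply_nonzero[OF assms(2)]]
  by (auto simp: cohomology_def dvd_def)

text \<open>Walk along the component: across an edge the two reductions coincide, and at a vertex
  the reductions along its two plane edges are congruent.\<close>

lemma cohomology_red_plane_dvd:
  assumes f: "f \<in> cohomology G \<alpha>" and W: "plane_vertex W p" and e: "e \<in> plane_at W p"
    and q: "q \<in> plane_comp W p" and b: "b \<in> plane_at W q"
  shows "plane_dvd W (red e (f p) - red b (f q))"
  using q b
proof (induction arbitrary: b rule: plane_comp_induct)
  case base
  then show ?case using plane_dvd_red_diff[OF W e] by simp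
next
  case (step b0)
  have "head G b0 \<in> plane_comp W p" using step by (auto intro: plane_comp_step)
  then have "plane_vertex W (head G b0)" using W by (rule plane_vertex_comp)
  moreover have "bar b0 \<in> plane_at W (head G b0)" "b0 \<in> plane_at W (tail G b0)"
    using step axial_bar_in_iff[OF _ plane_vertex_subspace[OF W]] by (auto simp: plane_at_iff)
  ultimately have "plane_dvd W (red b0 (f (head G b0)) - red b (f (head G b0)))"
    using plane_dvd_red_diff step red_bar by metis
  moreover have "plane_dvd W (red e (f p) - red b0 (f (tail G b0)))"
    using step \<open>b0 \<in> plane_at W (tail G b0)\<close> by blast
  ultimately show ?case
    using cohomology_red_eq[OF f] step plane_dvd_trans by metis
qed

text \<open>Partner edges lie in one plane component, which gives the congruence;
  \<open>sym_alg_on_dvd\<close> then moves the quotient into the subalgebra.\<close>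

lemma kirwan_map_in_reduced_cohomology:
  assumes c: "c \<notin> \<phi> ` verts G" and f: "f \<in> cohomology G \<alpha>"
  shows "kirwan_map G \<alpha> \<xi> \<phi> c f \<in> reduced_cohomology G \<alpha> \<xi> \<phi> c"
proof -
  let ?g = "kirwan_map G \<alpha> \<xi> \<phi> c f"
  have g_in: "?g e \<in> sym_alg_on (annihilator {\<xi>})" if "e \<in> crossing G \<phi> c" for e
    using that axial_apply_nonzero[of e]
    by (auto simp: kirwan_map_def crossing_def intro: sym_map_reduce_along_in)
  have "\<exists>x\<in>sym_alg_on (annihilator {\<xi>}).
      ?g e - ?g (crossing_partner G \<alpha> \<phi> c e a) = sym_gen (reduced_axial \<alpha> \<xi> e a) * x"
    if e: "e \<in> crossing G \<phi> c" and a: "a \<in> reduced_arcs_at G e" for e a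
  proof -
    let ?e' = "crossing_partner G \<alpha> \<phi> c e a" and ?W = "span {\<alpha> e, \<alpha> a}"
    let ?\<gamma> = "reduce_along \<xi> (\<alpha> e) (\<alpha> a)"
    have ea: "e \<in> arcs G" "a \<in> out_arcs G (tail G e)" "a \<noteq> e"
      using e a by (auto simp: crossing_def reduced_arcs_at_def)
    have e': "?e' \<in> plane_cut {q \<in> verts G. c < \<phi> q} ?W (tail G e)"
      using plane_cut_crossing_partner[OF c e a] by auto
    then have e'_cross: "?e' \<in> crossing G \<phi> c"
      by (auto simp: crossing_eq_cut[OF c] plane_cut_def)
    have "plane_dvd ?W (red e (f (tail G e)) - red ?e' (f (tail G ?e')))"
      by (rule cohomology_red_plane_dvd[OF f plane_vertexI[OF ea]])
        (use e' ea in \<open>auto simp: plane_at_iff plane_cut_def cut_arcs_def span_base\<close>)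
    then have "sym_gen ?\<gamma> dvd ?g e - ?g ?e'"
      using e e'_cross by (simp add: plane_dvd_span_iff[OF ea] kirwan_map_def)
    moreover have "?g e - ?g ?e' \<in> sym_alg_on (annihilator {\<xi>})"
      using sym_alg_on_add[OF g_in[OF e] sym_alg_on_mult[OF sym_alg_on_const g_in[OF e'_cross], of "- 1"]]
      by (simp add: sym_const_uminus)
    ultimately obtain x where "x \<in> sym_alg_on (annihilator {\<xi>})" "?g e - ?g ?e' = sym_gen ?\<gamma> * x"
      using sym_alg_on_dvd[OF axial_apply_nonzero[OF ea(1)]
          reduce_along_in_annihilator[OF axial_apply_nonzero[OF ea(1)]]] by metis
    then show ?thesis by (auto simp: reduced_axial_def reduce_along_def)
  qed
  then show ?thesis
    using g_in by (auto simp: reduced_cohomology_def kirwan_map_def)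
qed

text \<open>Two distinct cut arcs of a component are partners of each other, so the condition along
  a single reduced edge covers the pair.\<close>

lemma reduced_cohomology_compatible:
  assumes c: "c \<notin> \<phi> ` verts G" and g: "g \<in> reduced_cohomology G \<alpha> \<xi> \<phi> c"
    and W: "plane_vertex W p"
    and e: "e \<in> plane_cut {q \<in> verts G. c < \<phi> q} W p" and e': "e' \<in> plane_cut {q \<in> verts G. c < \<phi> q} W p"
  shows "plane_dvd W (g e - g e')"
proof (cases "e = e'")
  case False
  let ?U = "{q \<in> verts G. c < \<phi> q}"
  have e_at: "e \<in> plane_at W (tail G e)" "tail G e \<in> plane_comp W p" "e \<in> crossing G \<phi> c"
    using e by (auto simp: plane_cut_def plane_at_iff crossing_eq_cut[OF c] cut_arcs_def)
  note W' = plane_vertex_comp[OF e_at(2) W]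
  obtain a where "a \<noteq> e" "plane_at W (tail G e) = {e, a}"
    using plane_vertex_other[OF W' e_at(1)] .
  then have a: "a \<in> plane_at W (tail G e)" "a \<noteq> e" by auto
  have W_eq: "W = span {\<alpha> e, \<alpha> a}" using plane_vertex_span[OF W' e_at(1) a(1)] a(2) by blast
  have ea: "e \<in> arcs G" "a \<in> out_arcs G (tail G e)" "a \<in> reduced_arcs_at G e"
    using a e_at by (auto simp: plane_at_iff reduced_arcs_at_def)
  have "plane_cut ?U W p = plane_cut ?U W (tail G e)"
    using plane_comp_eq[OF plane_vertex_subspace[OF W] e_at(2)] by (simp add: plane_cut_def)
  also have "\<dots> = {e, crossing_partner G \<alpha> \<phi> c e a}"
    using plane_cut_crossing_partner[OF c e_at(3) ea(3)] by (simp add: W_eq)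
  finally have "e' = crossing_partner G \<alpha> \<phi> c e a" using e' False by auto
  then have "sym_gen (reduce_along \<xi> (\<alpha> e) (\<alpha> a)) dvd g e - g e'"
    using g e_at(3) ea(3) by (force simp: reduced_cohomology_def reduced_axial_def reduce_along_def)
  then show ?thesis by (simp add: W_eq plane_dvd_span_iff[OF ea(1,2) a(2)])
qed simp

text \<open>Negation exchanges the parts above and below a level, so one extension lemma serves both
  directions.\<close>

lemma polarized_skeleton_uminus: "polarized_skeleton G bar d \<theta> \<alpha> (- \<xi>) (\<lambda>q. - \<phi> q)"
proof unfold_locales
  show "three_independent G \<alpha>" "noncyclic G \<alpha>" by (fact three_indep noncyc)+
  show "- \<xi> \<in> polarizing G \<alpha>"
    using polarizing by (simp add: polarizing_def blinfun.minus_right)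
  show "inj_on (\<lambda>q. - \<phi> q) (verts G)"
    using inj_\<phi> by (simp add: inj_on_def)
  show "xi_compatible G \<alpha> (- \<xi>) (\<lambda>q. - \<phi> q)"
    using \<phi>_head_less by (simp add: xi_compatible_def blinfun.minus_right)
qed

text \<open>The preimage is glued from an extension \<open>f1\<close> above the level and an
  extension \<open>f2\<close> below it, both starting from \<open>g\<close> on the cut.\<close>

lemma reduced_cohomology_subset:
  assumes c: "c \<notin> \<phi> ` verts G" and g: "g \<in> reduced_cohomology G \<alpha> \<xi> \<phi> c"
  shows "\<exists>f\<in>cohomology G \<alpha>. kirwan_map G \<alpha> \<xi> \<phi> c f = g"
proof -
  \<comment> \<open>\<open>?L\<close> is written as a superlevel set of the negated function;
    regularity of \<open>c\<close> makes it the complement of \<open>?U\<close>.\<close>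
  let ?U = "{q \<in> verts G. c < \<phi> q}" and ?L = "{q \<in> verts G. - c < - \<phi> q}"
  have compl: "q \<in> ?L \<longleftrightarrow> q \<notin> ?U" if "q \<in> verts G" for q
    using that c by (metis (mono_tags, lifting) image_eqI linorder_neqE mem_Collect_eq neg_less_iff_less
        not_less_iff_gr_or_eq)
  have g_in: "g e \<in> sym_alg_on (annihilator {\<xi>})" if "e \<in> cut_arcs ?U" for e
    using that g by (auto simp: reduced_cohomology_def crossing_eq_cut[OF c])
  have compat: "compatible_on_cut ?U g"
    using reduced_cohomology_compatible[OF c g] by (auto simp: compatible_on_cut_def)
  obtain f1 where f1: "\<And>e. e \<in> arcs G \<Longrightarrow> tail G e \<in> ?U \<Longrightarrow>
      red e (f1 (tail G e)) = (if head G e \<in> ?U then red e (f1 (head G e)) else g e)"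
    using extension_from_cut[OF upper_set_superlevel compat g_in] by blast
  interpret N: polarized_skeleton G bar d \<theta> \<alpha> "- \<xi>" "\<lambda>q. - \<phi> q"
    by (rule polarized_skeleton_uminus)
  have ann: "annihilator {- \<xi>} = annihilator {\<xi>}"
    by (auto simp: annihilator_def blinfun.minus_right)
  \<comment> \<open>Arcs leaving \<open>?L\<close> point upwards, while \<open>g\<close> is indexed
    by downward orientations.\<close>
  have cut_bar: "bar e \<in> cut_arcs ?U" if "e \<in> cut_arcs ?L" for e
    using that compl by (auto simp: cut_arcs_def)
  have compat': "N.compatible_on_cut ?L (\<lambda>e. g (bar e))"
    unfolding N.compatible_on_cut_def
  proof (intro allI impI ballI)
    fix W p e e'
    assume W: "plane_vertex W p" and e: "e \<in> plane_cut ?L W p" and e': "e' \<in> plane_cut ?L W p"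
    have "bar b \<in> plane_cut ?U W p" if "b \<in> plane_cut ?L W p" for b
      using that cut_bar[of b] plane_comp_step[of b W p]
      by (auto simp: plane_cut_def cut_arcs_def axial_bar_in_iff[OF _ plane_vertex_subspace[OF W]])
    then have "plane_dvd W (g (bar e) - g (bar e'))"
      using reduced_cohomology_compatible[OF c g W] e e' by blast
    then show "N.plane_dvd W (g (bar e) - g (bar e'))"
      by (simp add: plane_dvd_def N.plane_dvd_def ann)
  qed
  obtain f2 where f2: "\<And>e. e \<in> arcs G \<Longrightarrow> tail G e \<in> ?L \<Longrightarrow>
      red e (f2 (tail G e)) = (if head G e \<in> ?L then red e (f2 (head G e)) else g (bar e))"
    using N.extension_from_cut[OF N.upper_set_superlevel compat', unfolded ann reduce_along_uminus, OF g_in]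
      cut_bar by blast
  define f where "f = (\<lambda>q\<in>verts G. if c < \<phi> q then f1 q else f2 q)"
  have f_U: "f q = f1 q" if "q \<in> ?U" for q using that by (simp add: f_def)
  have f_L: "f q = f2 q" if "q \<in> ?L" for q using that by (simp add: f_def)
  \<comment> \<open>Both halves take the value \<open>g e\<close> on the cut, so they agree across
    it.\<close>
  have red_cut: "red e (f (tail G e)) = g e \<and> red e (f (head G e)) = g e" if e: "e \<in> cut_arcs ?U" for e
  proof -
    have *: "e \<in> arcs G" "tail G e \<in> ?U" "head G e \<notin> ?U" "head G e \<in> ?L" "tail G e \<notin> ?L"
      using e compl by (auto simp: cut_arcs_def)
    have "red (bar e) (f2 (head G e)) = g e"
      using f2[of "bar e"] * by (simp del: mem_Collect_eq)
    then show ?thesis using * f1[of e] f_U f_L by (simp add: red_bar del: mem_Collect_eq)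
  qed
  have "red e (f (tail G e)) = red e (f (head G e))" if e: "e \<in> arcs G" for e
  proof (cases "tail G e \<in> ?U"; cases "head G e \<in> ?U")
    assume "tail G e \<in> ?U" "head G e \<in> ?U"
    then show ?thesis using f1[OF e] f_U by (simp del: mem_Collect_eq)
  next
    assume "tail G e \<in> ?U" "head G e \<notin> ?U"
    then show ?thesis using red_cut[of e] e by (simp add: cut_arcs_def)
  next
    assume "tail G e \<notin> ?U" "head G e \<in> ?U"
    then show ?thesis using red_cut[of "bar e"] e by (simp add: cut_arcs_def red_bar)
  next
    assume "tail G e \<notin> ?U" "head G e \<notin> ?U"
    then have "tail G e \<in> ?L" "head G e \<in> ?L" using e compl by auto
    then show ?thesis using f2[OF e] f_L by (simp del: mem_Collect_eq)
  qed
  then have "f \<in> cohomology G \<alpha>"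
    using sym_map_reduce_along_eq_iff axial_apply_nonzero
    by (fastforce simp: cohomology_def f_def dvd_def)
  moreover have "kirwan_map G \<alpha> \<xi> \<phi> c f = g"
  proof (rule extensionalityI)
    show "kirwan_map G \<alpha> \<xi> \<phi> c f \<in> extensional (crossing G \<phi> c)"
      by (simp add: kirwan_map_def)
    show "g \<in> extensional (crossing G \<phi> c)"
      using g by (auto simp: reduced_cohomology_def PiE_def)
    fix e assume "e \<in> crossing G \<phi> c"
    then show "kirwan_map G \<alpha> \<xi> \<phi> c f e = g e"
      using red_cut[of e] by (simp add: kirwan_map_def crossing_eq_cut[OF c])
  qed
  ultimately show ?thesis by blast
qed

end

theorem theorem2p5p3:
  fixes G :: "('v, 'e) pre_digraph"
    and bar :: "'e \<Rightarrow> 'e"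
    and d :: nat
    and \<theta> :: "'e \<Rightarrow> 'e \<Rightarrow> 'e"
    and \<alpha> :: "'e \<Rightarrow> 'g::euclidean_space \<Rightarrow>\<^sub>L real"
    and \<xi> :: 'g
    and \<phi> :: "'v \<Rightarrow> real"
    and c :: real
  assumes "abstract_one_skeleton G bar d \<theta> \<alpha>"
    and "three_independent G \<alpha>"
    and "noncyclic G \<alpha>"
    and "\<xi> \<in> polarizing G \<alpha>"
    and "generic_vector G \<alpha> \<xi>"
    and "inj_on \<phi> (verts G)"
    and "xi_compatible G \<alpha> \<xi> \<phi>"
    and "c \<notin> \<phi> ` verts G"
  shows "kirwan_map G \<alpha> \<xi> \<phi> c ` cohomology G \<alpha> = reduced_cohomology G \<alpha> \<xi> \<phi> c"
proof -
  interpret polarized_skeleton G bar d \<theta> \<alpha> \<xi> \<phi>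
    using assms by (simp add: polarized_skeleton_def polarized_skeleton_axioms_def)
  \<comment> \<open>One inclusion says that the values lie in the reduced ring, the other is
    surjectivity.\<close>
  show ?thesis
    using kirwan_map_in_reduced_cohomology[OF assms(8)] reduced_cohomology_subset[OF assms(8)]
    by blast
qed

end
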